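(* Let $X$ be a Banach space and let $J\in F(X)$ be lower semicontinuous. Then $J$ is strongly adequate if and only if its conjugate $J^*$ is essentially Fréchet differentiable on the Banach space $X^*$.
   Context: $X$ is a (real) Banach space with topological dual $X^*$ and bidual $X^{**}$; $\langle x,x^*\rangle:=x^*(x)$. $F(X)$ is the class of functions $J:X\to\mathbb{R}\cup\{+\infty\}$ with $\operatorname{dom}J:=\{x\in X: J(x)<\infty\}\neq\emptyset$. For a Banach space $Y$, $\Gamma(Y)$ is the set of lower semicontinuous proper convex functions on $Y$. Conjugate: $J^*(x^* ):=\sup_{x\in X}(\langle x,x^*\rangle-J(x))$ for $x^*\in X^*$. Subdifferential of a function $G$ on a Banach space $Y$: $\partial G(y):=\{y^*\in Y^*: G(v)\ge G(y)+\langle v-y,y^*\rangle\ \forall v\in Y\}$ if $G(y)\in\mathbb{R}$, and $\partial G(y):=\emptyset$ otherwise; $\operatorname{dom}\partial G:=\{y:\partial G(y)\neq\emptyset\}$. In particular $\partial J^*(x^* )\subset X^{**}$. A function $I\in F(X)$ attains a strong minimum over $X$ if it has a minimum point $\bar x\in X$ and every minimizing sequence $(x_n)$ (that is, $I(x_n)\to\inf_X I$) converges in norm to $\bar x$. $J\in F(X)$ is strongly adequate if $\operatorname{dom}\partial J^*$ is a nonempty open subset of $X^*$ and $J-x^*$ attains a strong minimum over $X$ for every $x^*\in\operatorname{dom}\partial J^*$. A function $G$ on a Banach space $Y$ is essentially Fréchet differentiable if $G\in\Gamma(Y)$, $\operatorname{int}(\operatorname{dom}\partial G)\neq\emptyset$,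 $G$ is Fréchet differentiable at each point of $\operatorname{int}(\operatorname{dom}\partial G)$, and $\|\nabla G(y_n)\|_*\to\infty$ (dual norm of $Y^*$) whenever $(y_n)$ is a sequence in $\operatorname{int}(\operatorname{dom}G)$ converging to some boundary point of $\operatorname{dom}G$. *)

theory Defs
  imports "HOL-Analysis.Analysis"
begin

text \<open>
  Extended-real-valued functions have type \<open>'a \<Rightarrow> ereal\<close>; the value \<open>-\<infinity>\<close> is excluded by
  \<open>proper_fun\<close>. The topological dual of \<open>'a\<close> is the Banach space \<open>'a \<Rightarrow>\<^sub>L real\<close> with the
  operator norm, so subgradients of a function on the dual live in the bidual
  \<open>('a \<Rightarrow>\<^sub>L real) \<Rightarrow>\<^sub>L real\<close>.
\<close>

definition edom :: "('a \<Rightarrow> ereal) \<Rightarrow> 'a set" where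
  "edom J = {x. J x < \<infinity>}"

definition proper_fun :: "('a \<Rightarrow> ereal) \<Rightarrow> bool" where
  "proper_fun J \<longleftrightarrow> (\<forall>x. J x \<noteq> -\<infinity>) \<and> edom J \<noteq> {}"

definition lsc_fun :: "('a::topological_space \<Rightarrow> ereal) \<Rightarrow> bool" where
  "lsc_fun J \<longleftrightarrow> (\<forall>x. J x \<le> Liminf (at x) J)"

text \<open>Restricting to \<open>0 < t < 1\<close> avoids the products \<open>0 * \<infinity>\<close>.\<close>

definition convex_fun :: "('a::real_vector \<Rightarrow> ereal) \<Rightarrow> bool" where
  "convex_fun J \<longleftrightarrow> (\<forall>x y t. 0 < t \<longrightarrow> t < 1 \<longrightarrow>
     J ((1 - t) *\<^sub>R x + t *\<^sub>R y) \<le> ereal (1 - t) * J x + ereal t * J y)"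

definition Gamma_class :: "('b::banach \<Rightarrow> ereal) set" where
  "Gamma_class = {G. lsc_fun G \<and> proper_fun G \<and> convex_fun G}"

definition conjugate :: "('a::real_normed_vector \<Rightarrow> ereal) \<Rightarrow> ('a \<Rightarrow>\<^sub>L real) \<Rightarrow> ereal" where
  "conjugate J \<xi> = (SUP x. ereal (blinfun_apply \<xi> x) - J x)"

definition subdiff :: "('b::real_normed_vector \<Rightarrow> ereal) \<Rightarrow> 'b \<Rightarrow> ('b \<Rightarrow>\<^sub>L real) set" where
  "subdiff G y = (if \<bar>G y\<bar> \<noteq> \<infinity>
     then {\<eta>. \<forall>v. G v \<ge> G y + ereal (blinfun_apply \<eta> (v - y))} else {})"

definition dom_subdiff :: "('b::real_normed_vector \<Rightarrow> ereal) \<Rightarrow> 'b set" where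
  "dom_subdiff G = {y. subdiff G y \<noteq> {}}"

definition attains_strong_min :: "('a::real_normed_vector \<Rightarrow> ereal) \<Rightarrow> bool" where
  "attains_strong_min I \<longleftrightarrow> (\<exists>xb. (\<forall>x. I xb \<le> I x) \<and>
     (\<forall>s :: nat \<Rightarrow> 'a. (\<lambda>n. I (s n)) \<longlonglongrightarrow> (INF x. I x) \<longrightarrow> s \<longlonglongrightarrow> xb))"

definition strongly_adequate :: "('a::banach \<Rightarrow> ereal) \<Rightarrow> bool" where
  "strongly_adequate J \<longleftrightarrow> proper_fun J \<and>
     dom_subdiff (conjugate J) \<noteq> {} \<and> open (dom_subdiff (conjugate J)) \<and>
     (\<forall>\<xi> \<in> dom_subdiff (conjugate J).
        attains_strong_min (\<lambda>x. J x - ereal (blinfun_apply \<xi> x)))"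

text \<open>
  Since \<open>real_of_ereal\<close> maps infinite values to \<open>0\<close>, finiteness near the point has to be
  required separately.
\<close>

definition frechet_differentiable_at :: "('b::real_normed_vector \<Rightarrow> ereal) \<Rightarrow> 'b \<Rightarrow> bool" where
  "frechet_differentiable_at G y \<longleftrightarrow> (\<forall>\<^sub>F v in nhds y. \<bar>G v\<bar> \<noteq> \<infinity>) \<and>
     (\<lambda>v. real_of_ereal (G v)) differentiable (at y)"

definition gradient :: "('b::real_normed_vector \<Rightarrow> ereal) \<Rightarrow> 'b \<Rightarrow> ('b \<Rightarrow>\<^sub>L real)" where
  "gradient G y = Blinfun (frechet_derivative (\<lambda>v. real_of_ereal (G v)) (at y))"

text \<open>
  The gradients in the last clause exist: for \<open>G \<in> Gamma_class\<close> on a Banach space, the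
  interiors of \<open>edom G\<close> and \<open>dom_subdiff G\<close> coincide.
\<close>

definition essentially_frechet_differentiable :: "('b::banach \<Rightarrow> ereal) \<Rightarrow> bool" where
  "essentially_frechet_differentiable G \<longleftrightarrow>
     G \<in> Gamma_class \<and>
     interior (dom_subdiff G) \<noteq> {} \<and>
     (\<forall>y \<in> interior (dom_subdiff G). frechet_differentiable_at G y) \<and>
     (\<forall>(s :: nat \<Rightarrow> 'b) b. (\<forall>n. s n \<in> interior (edom G)) \<longrightarrow> b \<in> frontier (edom G) \<longrightarrow>
        s \<longlonglongrightarrow> b \<longrightarrow> filterlim (\<lambda>n. norm (gradient G (s n))) at_top sequentially)"

end

theory Submission
  imports Defs
begin

text \<open>
  Write \<open>G\<close> for the conjugate of \<open>J\<close>. It is convex and lower semicontinuous, and once its domain is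
  nonempty the Baire category theorem makes it bounded above near each interior point of that
  domain (\<open>Gamma_class_bounded_near_interior\<close>).

  The Hahn-Banach theorem, in the form that a convex function vanishing at \<open>0\<close> has a linear minorant
  (\<open>hahn_banach_convex\<close>), turns the existence of a subgradient at \<open>y\<close> into calmness, that is, into the
  inequality \<open>G v \<ge> G y - C * norm (v - y)\<close> for some constant \<open>C\<close> and all \<open>v\<close>
  (\<open>dom_subdiff_iff_calm\<close>). Calmness is a family of inequalities between reals and survives limits.
  A convex function bounded above near a point is calm there (\<open>locally_bounded_imp_calm\<close>), so every
  interior point of the domain has a subgradient.

  At such an interior point \<open>\<xi>\<close>, differentiability of \<open>G\<close> and well-posedness of minimizing
  \<open>J - \<xi>\<close> are equivalent. If \<open>J - \<xi>\<close> has a strong minimum at \<open>xb\<close>, then a near maximizer \<open>x\<close> of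
  \<open>\<eta> - J\<close>, for \<open>\<eta>\<close> close to \<open>\<xi>\<close>, is a near minimizer of \<open>J - \<xi>\<close>, hence close to \<open>xb\<close>, and this forces
  evaluation at \<open>xb\<close> to be the derivative (\<open>strong_min_imp_frechet_differentiable\<close>). Conversely
  (Smulian), if \<open>G\<close> is differentiable at \<open>\<xi>\<close> then the evaluations at near minimizers of \<open>J - \<xi>\<close>
  approach the derivative in the norm of the bidual. Norming functionals bring this back to the
  space itself, so minimizing sequences are Cauchy, and lower semicontinuity of \<open>J\<close> makes
  their limit a minimum point (\<open>frechet_differentiable_imp_strong_min\<close>).

  What remains is the behaviour at the boundary. A boundary point that is the limit of points with
  bounded subgradients is calm, so it has a subgradient; if the domain of the subdifferential is
  open, there is no such boundary point, and the gradients must blow up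
  (\<open>gradients_blow_up_if_dom_subdiff_open\<close>). Conversely, if a boundary point \<open>b\<close> has a
  subgradient, then the gradients stay bounded along a segment from \<open>b\<close> into the interior, which
  contradicts blow-up; thus only interior points have subgradients
  (\<open>essentially_frechet_imp_dom_subdiff_eq\<close>).
\<close>

section \<open>Linear minorants of convex functions\<close>

text \<open>
  Zorn's lemma gives a minimal element among the convex minorants of \<open>p\<close> that vanish at \<open>0\<close>, and
  a minimal one is linear: the convex functions \<open>\<lambda>x. q (t *\<^sub>R x) / t\<close> with \<open>t \<le> 1\<close> lie below \<open>q\<close>, so
  minimality gives homogeneity and hence subadditivity, and then \<open>\<lambda>x. q (x + y) - q y\<close> lies
  below \<open>q\<close> too, so minimality gives additivity.
\<close>

lemma hahn_banach_convex:
  fixes p :: "'a::real_vector \<Rightarrow> real"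
  assumes p: "convex_on UNIV p" and p0: "p 0 = 0"
  obtains f where "linear f" "\<And>x. f x \<le> p x"
proof -
  define A where "A = {q::'a \<Rightarrow> real. convex_on UNIV q \<and> q 0 = 0 \<and> (\<forall>x. q x \<le> p x)}"
  define P where "P = (\<lambda>q u::'a \<Rightarrow> real. \<forall>x. u x \<le> q x)"
  (* A bound that does not depend on q makes pointwise infima of chains finite. *)
  have lower: "- p (- x) \<le> q x" if "q \<in> A" for q x
  proof -
    have "q ((1 - 1/2) *\<^sub>R x + (1/2) *\<^sub>R (- x)) \<le> (1 - 1/2) * q x + 1/2 * q (- x)"
      using that by (intro convex_onD[where A = UNIV]) (auto simp: A_def)
    then have "0 \<le> q x + q (- x)"
      using that by (simp add: A_def)
    moreover have "q (- x) \<le> p (- x)"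
      using that by (auto simp: A_def)
    ultimately show ?thesis by linarith
  qed
  have "\<exists>m\<in>A. \<forall>a\<in>A. P m a \<longrightarrow> a = m"
  proof (rule predicate_Zorn)
    show "partial_order_on A (relation_of P A)"
      by (rule partial_order_on_relation_ofI) (auto simp: P_def fun_eq_iff intro: order.trans antisym)
  next
    fix C assume C: "C \<in> Chains (relation_of P A)"
    have CA: "C \<subseteq> A" and chain: "\<And>q r. q \<in> C \<Longrightarrow> r \<in> C \<Longrightarrow> P q r \<or> P r q"
      using C unfolding Chains_def relation_of_def by auto
    show "\<exists>u\<in>A. \<forall>a\<in>C. P a u"
    proof (cases "C = {}")
      case True
      then show ?thesis using p p0 by (auto simp: A_def intro!: exI[of _ p])
    next
      case False
      define u where "u x = (INF q\<in>C. q x)" for x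
      have bdd: "bdd_below ((\<lambda>q. q x) ` C)" for x
        using lower CA by (intro bdd_belowI2[of _ "- p (- x)"]) auto
      have u_le: "u x \<le> q x" if "q \<in> C" for q x
        unfolding u_def using bdd that by (rule cINF_lower)
      have "convex_on UNIV u"
      proof (rule convex_onI)
        fix t :: real and x y :: 'a assume t: "0 < t" "t < 1"
        show "u ((1 - t) *\<^sub>R x + t *\<^sub>R y) \<le> (1 - t) * u x + t * u y"
        proof (rule field_le_epsilon)
          fix e :: real assume e: "0 < e"
          obtain q where q: "q \<in> C" "q x < u x + e"
            using cINF_less_iff[OF False bdd, of x "u x + e"] e by (auto simp: u_def)
          obtain r where r: "r \<in> C" "r y < u y + e"
            using cINF_less_iff[OF False bdd, of y "u y + e"] e by (auto simp: u_def)
          obtain s where s: "s \<in> C" "s x < u x + e" "s y < u y + e"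
            using chain[OF q(1) r(1)] q r unfolding P_def by (meson le_less_trans)
          have "u ((1 - t) *\<^sub>R x + t *\<^sub>R y) \<le> s ((1 - t) *\<^sub>R x + t *\<^sub>R y)"
            by (rule u_le[OF s(1)])
          also have "\<dots> \<le> (1 - t) * s x + t * s y"
            using s(1) CA t by (intro convex_onD[where A = UNIV]) (auto simp: A_def)
          also have "\<dots> \<le> (1 - t) * (u x + e) + t * (u y + e)"
            using s t by (intro add_mono mult_left_mono) auto
          finally show "u ((1 - t) *\<^sub>R x + t *\<^sub>R y) \<le> (1 - t) * u x + t * u y + e"
            by (simp add: algebra_simps)
        qed
      qed auto
      moreover have "u 0 = 0"
      proof -
        have "(\<lambda>q. q 0) ` C = {0}" using False CA by (auto simp: A_def)
        then show ?thesis by (simp add: u_def)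
      qed
      moreover have "u x \<le> p x" for x
      proof -
        obtain q where q: "q \<in> C" using False by auto
        then have "q x \<le> p x" using CA by (auto simp: A_def)
        with u_le[OF q] show ?thesis by (rule order.trans)
      qed
      ultimately have "u \<in> A" by (simp add: A_def)
      then show ?thesis using u_le by (auto simp: P_def)
    qed
  qed
  then obtain q where qA: "q \<in> A" and q_min: "\<And>r. r \<in> A \<Longrightarrow> P q r \<Longrightarrow> r = q"
    by blast
  have q: "convex_on UNIV q" "q 0 = 0" "\<And>x. q x \<le> p x"
    using qA by (auto simp: A_def)
  have min: "r = q" if "convex_on UNIV r" "r 0 = 0" "\<And>x. r x \<le> q x" for r
    using that q(3) by (intro q_min) (auto simp: A_def P_def intro: order.trans)
  have conv: "q ((1 - t) *\<^sub>R x + t *\<^sub>R y) \<le> (1 - t) * q x + t * q y"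
    if "0 \<le> t" "t \<le> 1" for t x y
    using q(1) that by (intro convex_onD[where A = UNIV]) auto
  have scale: "q (t *\<^sub>R x) = t * q x" if t: "0 < t" "t \<le> 1" for t x
  proof -
    have "(\<lambda>x. q (t *\<^sub>R x) / t) = q"
    proof (rule min)
      show "convex_on UNIV (\<lambda>x. q (t *\<^sub>R x) / t)"
      proof (rule convex_onI)
        fix s :: real and x y :: 'a assume s: "0 < s" "s < 1"
        have "q (t *\<^sub>R ((1 - s) *\<^sub>R x + s *\<^sub>R y)) = q ((1 - s) *\<^sub>R (t *\<^sub>R x) + s *\<^sub>R (t *\<^sub>R y))"
          by (simp add: scaleR_right_distrib mult.commute)
        also have "\<dots> \<le> (1 - s) * q (t *\<^sub>R x) + s * q (t *\<^sub>R y)"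
          using s by (intro conv) auto
        finally show "q (t *\<^sub>R ((1 - s) *\<^sub>R x + s *\<^sub>R y)) / t
            \<le> (1 - s) * (q (t *\<^sub>R x) / t) + s * (q (t *\<^sub>R y) / t)"
          using t by (simp add: field_simps)
      qed auto
      fix x show "q (t *\<^sub>R x) / t \<le> q x"
        using conv[of t 0 x] t q(2) by (simp add: field_simps)
    qed (use q in auto)
    from fun_cong[OF this, of x] show ?thesis using t by (simp add: field_simps)
  qed
  have subadd: "q (x + y) \<le> q x + q y" for x y
    using conv[of "1/2" x y] scale[of "1/2" "x + y"] by (simp add: scaleR_right_distrib)
  have add: "q (x + y) = q x + q y" for x y
  proof -
    have "(\<lambda>x. q (x + y) - q y) = q"
    proof (rule min)
      show "convex_on UNIV (\<lambda>x. q (x + y) - q y)"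
      proof (rule convex_onI)
        fix s :: real and a b :: 'a assume s: "0 < s" "s < 1"
        have "(1 - s) *\<^sub>R a + s *\<^sub>R b + y = (1 - s) *\<^sub>R (a + y) + s *\<^sub>R (b + y)"
          by (simp add: algebra_simps)
        then show "q ((1 - s) *\<^sub>R a + s *\<^sub>R b + y) - q y
            \<le> (1 - s) * (q (a + y) - q y) + s * (q (b + y) - q y)"
          using conv[of s "a + y" "b + y"] s by (simp add: algebra_simps)
      qed auto
      show "q (x + y) - q y \<le> q x" for x using subadd[of x y] by simp
    qed simp
    from fun_cong[OF this, of x] show ?thesis by simp
  qed
  have neg: "q (- x) = - q x" for x
    using add[of x "- x"] q(2) by simp
  have pos: "q (t *\<^sub>R x) = t * q x" if "0 < t" for t x
  proof (cases "t \<le> 1")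
    case False
    then show ?thesis using scale[of "1/t" "t *\<^sub>R x"] that by (simp add: field_simps)
  qed (use scale that in auto)
  have "q (t *\<^sub>R x) = t * q x" for t x
    using pos[of t x] pos[of "- t" x] neg[of "t *\<^sub>R x"] q(2)
    by (cases t "0::real" rule: linorder_cases) auto
  then have "linear q" using add by (intro linearI) auto
  then show thesis using q(3) by (rule that)
qed

text \<open>
  A linear minorant of \<open>\<lambda>h. norm (x + h) - norm x\<close> lies below the norm, and evaluating it at
  \<open>- x\<close> shows that it takes at least the value \<open>norm x\<close> at \<open>x\<close>.
\<close>

lemma norming_functional:
  fixes x :: "'a::real_normed_vector"
  obtains f :: "'a \<Rightarrow>\<^sub>L real" where "norm f \<le> 1" "blinfun_apply f x = norm x"
proof -
  have "convex_on UNIV (\<lambda>h. norm (x + h) - norm x)"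
  proof (rule convex_onI)
    fix t :: real and a b :: 'a assume t: "0 < t" "t < 1"
    have "x + ((1 - t) *\<^sub>R a + t *\<^sub>R b) = (1 - t) *\<^sub>R (x + a) + t *\<^sub>R (x + b)"
      by (simp add: algebra_simps)
    then have "norm (x + ((1 - t) *\<^sub>R a + t *\<^sub>R b)) \<le> (1 - t) * norm (x + a) + t * norm (x + b)"
      using t norm_triangle_ineq[of "(1 - t) *\<^sub>R (x + a)" "t *\<^sub>R (x + b)"] by simp
    then show "norm (x + ((1 - t) *\<^sub>R a + t *\<^sub>R b)) - norm x
        \<le> (1 - t) * (norm (x + a) - norm x) + t * (norm (x + b) - norm x)"
      by (simp add: algebra_simps)
  qed auto
  then obtain f where f: "linear f" "\<And>h. f h \<le> norm (x + h) - norm x"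
    using hahn_banach_convex[of "\<lambda>h. norm (x + h) - norm x"] by (metis add.right_neutral diff_self)
  have up: "f h \<le> norm h" for h
    using f(2)[of h] norm_triangle_ineq[of x h] by simp
  have bound: "\<bar>f h\<bar> \<le> norm h * 1" for h
    using up[of h] up[of "- h"] linear_neg[OF f(1), of h] by simp
  have bl: "bounded_linear f"
    using f(1) bound by (auto simp: bounded_linear_def bounded_linear_axioms_def intro!: exI[of _ 1])
  show thesis
  proof
    show "norm (Blinfun f) \<le> 1"
      using bound by (intro norm_blinfun_bound) (auto simp: bounded_linear_Blinfun_apply[OF bl])
    have "norm x \<le> f x"
      using f(2)[of "- x"] linear_neg[OF f(1), of x] by simp
    then show "blinfun_apply (Blinfun f) x = norm x"
      using up[of x] by (simp add: bounded_linear_Blinfun_apply[OF bl])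
  qed
qed

section \<open>Calm points of convex functions\<close>

text \<open>
  The function \<open>p\<close> in the proof is the infimal convolution of \<open>\<lambda>h. g (b + h) - g b\<close> with
  \<open>\<lambda>h. C * norm h\<close>. Calmness says that \<open>p\<close> is finite and vanishes at \<open>0\<close>. A linear minorant of \<open>p\<close>
  lies below both functions, so it is a subgradient and it is bounded.
\<close>

lemma calm_imp_subgradient:
  fixes g :: "'b::real_normed_vector \<Rightarrow> real"
  assumes g: "convex_on D g" and b: "b \<in> D" and C: "0 \<le> C"
    and calm: "\<And>v. v \<in> D \<Longrightarrow> g b - C * norm (v - b) \<le> g v"
  obtains \<eta> :: "'b \<Rightarrow>\<^sub>L real" where "\<And>v. v \<in> D \<Longrightarrow> g b + blinfun_apply \<eta> (v - b) \<le> g v"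
proof -
  define k where "k h v = g v - g b + C * norm (h - (v - b))" for h v
  define p where "p h = (INF v\<in>D. k h v)" for h
  have lower: "- C * norm h \<le> k h v" if "v \<in> D" for h v
  proof -
    have "C * norm (v - b) \<le> C * (norm (h - (v - b)) + norm h)"
      using norm_triangle_ineq4[of h "h - (v - b)"] C by (intro mult_left_mono) auto
    then show ?thesis using calm[OF that] by (simp add: k_def algebra_simps)
  qed
  have bdd: "bdd_below (k h ` D)" for h
    using lower by (intro bdd_belowI2[of _ "- C * norm h"]) auto
  have ne: "D \<noteq> {}" using b by auto
  have p_le: "p h \<le> k h v" if "v \<in> D" for h v
    unfolding p_def using bdd that by (rule cINF_lower)
  have "convex_on UNIV p"
  proof (rule convex_onI)
    fix t :: real and x y :: 'b assume t: "0 < t" "t < 1"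
    show "p ((1 - t) *\<^sub>R x + t *\<^sub>R y) \<le> (1 - t) * p x + t * p y"
    proof (rule field_le_epsilon)
      fix e :: real assume e: "0 < e"
      obtain u where u: "u \<in> D" "k x u < p x + e"
        using cINF_less_iff[OF ne bdd, of x "p x + e"] e by (auto simp: p_def)
      obtain v where v: "v \<in> D" "k y v < p y + e"
        using cINF_less_iff[OF ne bdd, of y "p y + e"] e by (auto simp: p_def)
      define w where "w = (1 - t) *\<^sub>R u + t *\<^sub>R v"
      have wD: "w \<in> D"
        using convex_on_imp_convex[OF g] u v t unfolding w_def convex_alt by auto
      have gw: "g w \<le> (1 - t) * g u + t * g v"
        unfolding w_def using g u v t by (intro convex_onD) auto
      have "(1 - t) *\<^sub>R x + t *\<^sub>R y - (w - b) = (1 - t) *\<^sub>R (x - (u - b)) + t *\<^sub>R (y - (v - b))"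
        by (simp add: w_def algebra_simps)
      then have "norm ((1 - t) *\<^sub>R x + t *\<^sub>R y - (w - b))
          \<le> (1 - t) * norm (x - (u - b)) + t * norm (y - (v - b))"
        using t norm_triangle_ineq[of "(1 - t) *\<^sub>R (x - (u - b))" "t *\<^sub>R (y - (v - b))"] by simp
      from mult_left_mono[OF this C] gw
      have "k ((1 - t) *\<^sub>R x + t *\<^sub>R y) w \<le> (1 - t) * k x u + t * k y v"
        by (simp add: k_def algebra_simps)
      also have "\<dots> \<le> (1 - t) * (p x + e) + t * (p y + e)"
        using u v t by (intro add_mono mult_left_mono) auto
      finally show "p ((1 - t) *\<^sub>R x + t *\<^sub>R y) \<le> (1 - t) * p x + t * p y + e"
        using p_le[OF wD, of "(1 - t) *\<^sub>R x + t *\<^sub>R y"] by (simp add: algebra_simps)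
    qed
  qed auto
  moreover have "p 0 = 0"
  proof (rule antisym)
    show "p 0 \<le> 0" using p_le[OF b, of 0] by (simp add: k_def)
    show "0 \<le> p 0" unfolding p_def using lower[of _ 0] by (intro cINF_greatest ne) auto
  qed
  ultimately obtain f where f: "linear f" "\<And>h. f h \<le> p h"
    by (rule hahn_banach_convex) (assumption | rule that)+
  have up: "f h \<le> C * norm h" for h
    using f(2)[of h] p_le[OF b, of h] by (simp add: k_def)
  have bound: "\<bar>f h\<bar> \<le> norm h * C" for h
    using up[of h] up[of "- h"] linear_neg[OF f(1), of h] by (simp add: mult.commute)
  have bl: "bounded_linear f"
    using f(1) bound by (auto simp: bounded_linear_def bounded_linear_axioms_def)
  show thesis
  proof
    fix v assume "v \<in> D"
    then show "g b + blinfun_apply (Blinfun f) (v - b) \<le> g v"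
      using f(2)[of "v - b"] p_le[of v "v - b"]
      by (simp add: bounded_linear_Blinfun_apply[OF bl] k_def)
  qed
qed

text \<open>
  Convexity on the line through \<open>v\<close> and \<open>y\<close>: a steep descent from \<open>y\<close> to \<open>v\<close> would force an equally
  steep ascent on the opposite side of \<open>y\<close>, where \<open>g\<close> is at most \<open>M\<close>.
\<close>

lemma locally_bounded_imp_calm:
  fixes g :: "'b::real_normed_vector \<Rightarrow> real"
  assumes g: "convex_on D g" and r: "0 < r" "ball y r \<subseteq> D"
    and M: "\<And>v. v \<in> ball y r \<Longrightarrow> g v \<le> M"
  obtains C where "0 \<le> C" "\<And>v. v \<in> D \<Longrightarrow> g y - C * norm (v - y) \<le> g v"
proof
  define \<rho> where "\<rho> = r / 2"
  have \<rho>: "0 < \<rho>" "\<rho> < r" using r by (auto simp: \<rho>_def)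
  have yM: "g y \<le> M" using M r by simp
  show "0 \<le> (M - g y) / \<rho>" using yM \<rho> by simp
  fix v assume v: "v \<in> D"
  show "g y - (M - g y) / \<rho> * norm (v - y) \<le> g v"
  proof (cases "v = y")
    case False
    define d where "d = norm (v - y)"
    have d: "0 < d" using False by (simp add: d_def)
    (* y lies between v and the point w at distance \<rho> on the far side of y. *)
    define w where "w = y - (\<rho> / d) *\<^sub>R (v - y)"
    define t where "t = d / (d + \<rho>)"
    have "dist y w = \<rho>" using \<rho> d by (simp add: w_def dist_norm flip: d_def)
    then have w: "w \<in> ball y r" using \<rho> by simp
    have "(1 - t) *\<^sub>R v + t *\<^sub>R w = y + ((1 - t) - t * (\<rho> / d)) *\<^sub>R (v - y)"
      by (simp add: w_def algebra_simps)
    moreover have "(1 - t) - t * (\<rho> / d) = 0" using d \<rho> by (simp add: t_def field_simps)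
    ultimately have "y = (1 - t) *\<^sub>R v + t *\<^sub>R w" by simp
    then have "g y \<le> (1 - t) * g v + t * g w"
      using convex_onD[OF g, of t v w] v w r d \<rho> by (auto simp: t_def)
    also have "\<dots> \<le> (1 - t) * g v + t * M"
      using M[OF w] d \<rho> by (intro add_left_mono mult_left_mono) (auto simp: t_def)
    finally have "(d + \<rho>) * g y \<le> (d + \<rho>) * ((1 - t) * g v + t * M)"
      using d \<rho> by (intro mult_left_mono) auto
    also have "\<dots> = \<rho> * g v + d * M"
    proof -
      have "(d + \<rho>) * t = d" using d \<rho> by (simp add: t_def)
      moreover have "(d + \<rho>) * (1 - t) = \<rho>" using calculation by (simp add: right_diff_distrib)
      moreover have "(d + \<rho>) * ((1 - t) * g v + t * M)
          = ((d + \<rho>) * (1 - t)) * g v + ((d + \<rho>) * t) * M"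
        by (simp only: distrib_left mult.assoc)
      ultimately show ?thesis by simp
    qed
    finally show ?thesis using \<rho> by (simp add: field_simps flip: d_def)
  qed simp
qed

text \<open>
  An upper bound on one ball spreads to the whole interior: \<open>y\<close> is a convex combination of \<open>z\<close>
  and some point \<open>w\<close> of the domain, with positive weight at \<open>z\<close>, and the homothety with centre \<open>w\<close> that takes \<open>z\<close> to \<open>y\<close> carries the
  ball around \<open>z\<close> to one around \<open>y\<close>.
\<close>

lemma convex_on_bounded_near_interior:
  fixes g :: "'b::real_normed_vector \<Rightarrow> real"
  assumes g: "convex_on D g" and \<rho>: "0 < \<rho>" "ball z \<rho> \<subseteq> D"
    and K: "\<And>v. v \<in> ball z \<rho> \<Longrightarrow> g v \<le> K" and y: "y \<in> interior D"
  obtains r M where "0 < r" "ball y r \<subseteq> D" "\<And>v. v \<in> ball y r \<Longrightarrow> g v \<le> M"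
proof -
  obtain s where s: "0 < s" "ball y s \<subseteq> D" using y by (auto simp: mem_interior)
  define \<tau> where "\<tau> = s / (2 * (norm (z - y) + 1))"
  have nz: "0 < norm (z - y) + 1" by (smt (verit) norm_ge_zero)
  have \<tau>: "0 < \<tau>" using s nz by (simp add: \<tau>_def)
  define w where "w = y - \<tau> *\<^sub>R (z - y)"
  define t where "t = \<tau> / (1 + \<tau>)"
  have t: "0 < t" "t < 1" using \<tau> by (auto simp: t_def)
  have "\<tau> * norm (z - y) \<le> \<tau> * (norm (z - y) + 1)" using \<tau> by simp
  also have "\<dots> = s / 2" using nz by (simp add: \<tau>_def field_simps)
  finally have "w \<in> ball y s" using s \<tau> by (simp add: w_def dist_norm)
  then have w: "w \<in> D" using s by auto
  have "(1 - t) *\<^sub>R w + t *\<^sub>R z = y + (t - (1 - t) * \<tau>) *\<^sub>R (z - y)"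
    by (simp add: w_def algebra_simps)
  moreover have "t - (1 - t) * \<tau> = 0" using \<tau> by (simp add: t_def field_simps)
  ultimately have yw: "(1 - t) *\<^sub>R w + t *\<^sub>R z = y" by simp
  have main: "v \<in> D \<and> g v \<le> (1 - t) * g w + t * K" if "v \<in> ball y (t * \<rho>)" for v
  proof -
    define x where "x = z + (1 / t) *\<^sub>R (v - y)"
    have "dist z x = norm (v - y) / t" using t by (simp add: x_def dist_norm)
    also have "\<dots> < \<rho>"
      using that t by (simp add: dist_norm norm_minus_commute field_simps)
    finally have x: "x \<in> ball z \<rho>" by simp
    have "(1 - t) *\<^sub>R w + t *\<^sub>R x = ((1 - t) *\<^sub>R w + t *\<^sub>R z) + (v - y)"
      using t by (simp add: x_def scaleR_right_distrib)
    then have v: "v = (1 - t) *\<^sub>R w + t *\<^sub>R x" using yw by simp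
    have xD: "x \<in> D" using x \<rho> by auto
    have "g v \<le> (1 - t) * g w + t * g x"
      unfolding v using g w xD t by (intro convex_onD) auto
    also have "\<dots> \<le> (1 - t) * g w + t * K"
      using K[OF x] t by simp
    finally show ?thesis
      using convex_on_imp_convex[OF g] w xD t unfolding v convex_alt by auto
  qed
  show thesis
    by (rule that[of "t * \<rho>" "(1 - t) * g w + t * K"]) (use main t \<rho> in auto)
qed

text \<open>
  The difference quotients from \<open>y\<close> towards \<open>v\<close> are at most \<open>g v - g y\<close>, and they tend to
  \<open>g' (v - y)\<close>.
\<close>

lemma derivative_imp_subgradient:
  fixes g :: "'b::real_normed_vector \<Rightarrow> real"
  assumes g: "convex_on D g" and y: "y \<in> D" and v: "v \<in> D"
    and g': "(g has_derivative g') (at y)"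
  shows "g y + g' (v - y) \<le> g v"
proof -
  have lin: "g' (t *\<^sub>R h) = t * g' h" for t h
    using has_derivative_linear[OF g'] by (simp add: linear_cmul)
  have "((\<lambda>t. g (y + t *\<^sub>R (v - y))) has_derivative (\<lambda>t. g' (t *\<^sub>R (v - y)))) (at 0)"
    by (rule has_derivative_compose[of "\<lambda>t. y + t *\<^sub>R (v - y)" "\<lambda>t. t *\<^sub>R (v - y)" 0 UNIV g g'])
       (auto intro!: derivative_eq_intros g')
  then have "((\<lambda>t. g (y + t *\<^sub>R (v - y))) has_real_derivative g' (v - y)) (at 0)"
    by (simp add: has_field_derivative_def lin mult.commute[of _ "g' (v - y)"] mult_commute_abs)
  then have "((\<lambda>t. (g (y + t *\<^sub>R (v - y)) - g y) / t) \<longlongrightarrow> g' (v - y)) (at_right 0)"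
    by (auto simp: has_field_derivative_iff intro: tendsto_within_subset)
  moreover have "\<forall>\<^sub>F t in at_right 0. (g (y + t *\<^sub>R (v - y)) - g y) / t \<le> g v - g y"
  proof -
    have "(g (y + t *\<^sub>R (v - y)) - g y) / t \<le> g v - g y" if "0 < t" "t < 1" for t
      using convex_onD[OF g, of t y v] y v that by (simp add: algebra_simps field_simps)
    then show ?thesis unfolding eventually_at_right_field by (intro exI[of _ 1]) auto
  qed
  ultimately have "g' (v - y) \<le> g v - g y"
    by (intro tendsto_upperbound) auto
  then show ?thesis by simp
qed


lemma norm_blinfun_le_of_bounded_on_ball:
  fixes \<eta> :: "'b::real_normed_vector \<Rightarrow>\<^sub>L real"
  assumes r: "0 < r" and K: "\<And>h. norm h < r \<Longrightarrow> blinfun_apply \<eta> h \<le> K"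
  shows "norm \<eta> \<le> 2 * K / r"
proof (rule norm_blinfun_bound)
  show "0 \<le> 2 * K / r" using K[of 0] r by simp
  fix h
  have up: "blinfun_apply \<eta> h \<le> 2 * K / r * norm h" for h
  proof (cases "h = 0")
    case False
    have "blinfun_apply \<eta> ((r / (2 * norm h)) *\<^sub>R h) \<le> K"
      using False r by (intro K) simp
    then show ?thesis using False r by (simp add: blinfun.scaleR_right field_simps)
  qed simp
  show "norm (blinfun_apply \<eta> h) \<le> 2 * K / r * norm h"
    using up[of h] up[of "- h"] by (simp add: blinfun.minus_right abs_le_iff)
qed

text \<open>
  The subgradient inequality for \<open>\<eta>\<close> tested at \<open>b\<close>, combined with calmness at \<open>b\<close>, bounds
  \<open>\<eta> (u - b)\<close> from below independently of \<open>t\<close>; tested on the ball around \<open>u\<close>, where \<open>g\<close> is bounded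
  above, it then bounds \<open>\<eta>\<close> on a ball around \<open>0\<close>.
\<close>

lemma subgradients_bounded_along_segment:
  fixes g :: "'b::real_normed_vector \<Rightarrow> real"
  assumes r: "0 < r" "ball u r \<subseteq> D" and M: "\<And>v. v \<in> ball u r \<Longrightarrow> g v \<le> M"
    and b: "b \<in> D" and C: "0 \<le> C" and calm: "\<And>v. v \<in> D \<Longrightarrow> g b - C * norm (v - b) \<le> g v"
    and t: "0 < t" "t \<le> 1" and s: "s = b + t *\<^sub>R (u - b)" "s \<in> D"
    and \<eta>: "\<And>v. v \<in> D \<Longrightarrow> g s + blinfun_apply \<eta> (v - s) \<le> g v"
  shows "norm \<eta> \<le> 2 * (M - g b + 2 * C * norm (u - b)) / r"
proof (rule norm_blinfun_le_of_bounded_on_ball[OF r(1)])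
  fix h :: 'b assume "norm h < r"
  then have uh: "u + h \<in> ball u r" by (simp add: dist_norm)
  have "norm (s - b) = t * norm (u - b)" using s(1) t by simp
  then have gs: "g b - t * (C * norm (u - b)) \<le> g s"
    using calm[OF s(2)] by (simp add: algebra_simps)
  have tC: "t * (C * norm (u - b)) \<le> C * norm (u - b)"
    using t C by (simp add: mult_left_le_one_le)
  have "b - s = - (t *\<^sub>R (u - b))" using s(1) by simp
  then have "t * (- (C * norm (u - b))) \<le> t * blinfun_apply \<eta> (u - b)"
    using \<eta>[OF b] gs by (simp add: blinfun.minus_right blinfun.scaleR_right)
  then have *: "- (C * norm (u - b)) \<le> blinfun_apply \<eta> (u - b)"
    using t by (simp only: mult_le_cancel_left_pos)
  have "(1 - t) * (- (C * norm (u - b))) \<le> (1 - t) * blinfun_apply \<eta> (u - b)"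
    using * t by (intro mult_left_mono) auto
  moreover have "(1 - t) * (C * norm (u - b)) \<le> C * norm (u - b)"
    using t C by (simp add: mult_left_le_one_le)
  moreover have "u + h - s = (1 - t) *\<^sub>R (u - b) + h" by (simp add: s(1) algebra_simps)
  then have "blinfun_apply \<eta> (u + h - s) = (1 - t) * blinfun_apply \<eta> (u - b) + blinfun_apply \<eta> h"
 
    by (simp only: blinfun.add_right blinfun.scaleR_right real_scaleR_def)
  moreover have "g s + blinfun_apply \<eta> (u + h - s) \<le> M"
    using \<eta>[of "u + h"] M[OF uh] uh r(2) by force
  ultimately show "blinfun_apply \<eta> h \<le> M - g b + 2 * C * norm (u - b)"
    using gs tC by linarith
qed

section \<open>Extended-real-valued functions through their finite parts\<close>

lemma edom_real:
  assumes "proper_fun G" "v \<in> edom G"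
  shows "G v = ereal (real_of_ereal (G v))"
  using assms by (auto simp: proper_fun_def edom_def ereal_real)

lemma convex_fun_imp_convex_on:
  assumes G: "proper_fun G" "convex_fun G"
  shows "convex_on (edom G) (\<lambda>v. real_of_ereal (G v))"
proof -
  have *: "G ((1 - t) *\<^sub>R x + t *\<^sub>R y)
      \<le> ereal ((1 - t) * real_of_ereal (G x) + t * real_of_ereal (G y))"
    if "0 < t" "t < 1" "x \<in> edom G" "y \<in> edom G" for t x y
  proof -
    have "G ((1 - t) *\<^sub>R x + t *\<^sub>R y) \<le> ereal (1 - t) * G x + ereal t * G y"
      using G(2) that by (simp add: convex_fun_def)
    also have "\<dots> = ereal ((1 - t) * real_of_ereal (G x) + t * real_of_ereal (G y))"
      by (subst edom_real[OF G(1) that(3)], subst edom_real[OF G(1) that(4)]) simp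
    finally show ?thesis .
  qed
  have dom: "(1 - t) *\<^sub>R x + t *\<^sub>R y \<in> edom G"
    if "0 < t" "t < 1" "x \<in> edom G" "y \<in> edom G" for t x y
    using *[OF that] by (auto simp: edom_def)
  show ?thesis
  proof (rule convex_onI)
    fix t :: real and x y assume A: "0 < t" "t < 1" "x \<in> edom G" "y \<in> edom G"
    show "real_of_ereal (G ((1 - t) *\<^sub>R x + t *\<^sub>R y))
        \<le> (1 - t) * real_of_ereal (G x) + t * real_of_ereal (G y)"
      using *[OF A] by (subst (asm) edom_real[OF G(1) dom[OF A]]) simp
  next
    show "convex (edom G)"
      unfolding convex_alt
    proof (intro ballI allI impI)
      fix x y and u :: real assume "x \<in> edom G" "y \<in> edom G" "0 \<le> u \<and> u \<le> 1"
      then show "(1 - u) *\<^sub>R x + u *\<^sub>R y \<in> edom G"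
        using dom[of u x y] by (cases "u = 0"; cases "u = 1") auto
    qed
  qed
qed

lemma subdiff_iff:
  assumes G: "proper_fun G"
  shows "\<eta> \<in> subdiff G y \<longleftrightarrow> y \<in> edom G \<and>
    (\<forall>v\<in>edom G. real_of_ereal (G y) + blinfun_apply \<eta> (v - y) \<le> real_of_ereal (G v))"
proof (cases "y \<in> edom G")
  case True
  have "G y + ereal (blinfun_apply \<eta> (v - y)) \<le> G v \<longleftrightarrow>
      (v \<in> edom G \<longrightarrow> real_of_ereal (G y) + blinfun_apply \<eta> (v - y) \<le> real_of_ereal (G v))" for v
  proof (cases "v \<in> edom G")
    case False
    then show ?thesis by (auto simp: edom_def)
  next
    case v: True
    show ?thesis
    proof -
      have "G y + ereal (blinfun_apply \<eta> (v - y))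
          = ereal (real_of_ereal (G y) + blinfun_apply \<eta> (v - y))"
        by (subst edom_real[OF G True]) simp
      moreover note edom_real[OF G v]
      ultimately show ?thesis using v by (metis ereal_less_eq(3))
    qed
  qed
  moreover have "\<bar>G y\<bar> \<noteq> \<infinity>" by (subst edom_real[OF G True]) simp
  ultimately show ?thesis using True by (auto simp: subdiff_def)
next
  case False
  then show ?thesis by (auto simp: subdiff_def edom_def)
qed

lemma dom_subdiff_subset_edom:
  "proper_fun G \<Longrightarrow> dom_subdiff G \<subseteq> edom G"
  by (auto simp: dom_subdiff_def subdiff_iff)

text \<open>
  The norm of a subgradient is a constant of calmness. The right-hand side speaks of real numbers
  only, which is what makes limits of points with a subgradient tractable.
\<close>

lemma dom_subdiff_iff_calm:
  assumes G: "proper_fun G" "convex_fun G"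
  shows "y \<in> dom_subdiff G \<longleftrightarrow> y \<in> edom G \<and>
    (\<exists>C\<ge>0. \<forall>v\<in>edom G. real_of_ereal (G y) - C * norm (v - y) \<le> real_of_ereal (G v))"
    (is "?L \<longleftrightarrow> ?R")
proof
  assume ?L
  then obtain \<eta> where \<eta>: "\<eta> \<in> subdiff G y" by (auto simp: dom_subdiff_def)
  have "real_of_ereal (G y) - norm \<eta> * norm (v - y) \<le> real_of_ereal (G v)" if "v \<in> edom G" for v
    using \<eta> that norm_blinfun[of \<eta> "v - y"] by (fastforce simp: subdiff_iff[OF G(1)])
  then show ?R using \<eta> by (auto simp: subdiff_iff[OF G(1)] intro!: exI[of _ "norm \<eta>"])
next
  assume ?R
  then obtain C where C: "y \<in> edom G" "0 \<le> C"
    "\<And>v. v \<in> edom G \<Longrightarrow> real_of_ereal (G y) - C * norm (v - y) \<le> real_of_ereal (G v)" by blast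
  obtain \<eta> :: "'a \<Rightarrow>\<^sub>L real" where
    "\<And>v. v \<in> edom G \<Longrightarrow> real_of_ereal (G y) + blinfun_apply \<eta> (v - y) \<le> real_of_ereal (G v)"
    using calm_imp_subgradient[OF convex_fun_imp_convex_on[OF G] C] by blast
  then have "\<eta> \<in> subdiff G y" using C(1) by (simp add: subdiff_iff[OF G(1)])
  then show ?L by (auto simp: dom_subdiff_def)
qed

text \<open>
  A punctured neighbourhood may be replaced by a full one, since \<open>c < G x\<close> is assumed.
\<close>

lemma lsc_fun_iff_eventually:
  "lsc_fun G \<longleftrightarrow> (\<forall>x c. c < G x \<longrightarrow> (\<forall>\<^sub>F y in nhds x. c < G y))"
proof -
  have "(\<forall>\<^sub>F y in nhds x. c < G y) \<longleftrightarrow> (\<forall>\<^sub>F y in at x. c < G y)" if "c < G x" for c x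
    using that by (auto simp: eventually_at_filter elim: eventually_mono)
  then show ?thesis unfolding lsc_fun_def le_Liminf_iff by blast
qed

text \<open>
  The closed sublevel sets \<open>F n\<close> cover the domain, so by the Baire category theorem one of them
  contains a ball, and the bound on that ball spreads by convexity.
\<close>

lemma Gamma_class_bounded_near_interior:
  fixes G :: "'b::banach \<Rightarrow> ereal"
  assumes G: "G \<in> Gamma_class" and y: "y \<in> interior (edom G)"
  obtains r M where "0 < r" "ball y r \<subseteq> edom G" "\<And>v. v \<in> ball y r \<Longrightarrow> real_of_ereal (G v) \<le> M"
proof -
  have proper: "proper_fun G" and conv: "convex_fun G" and lsc: "lsc_fun G"
    using G by (auto simp: Gamma_class_def)
  define F where "F n = {v. G v \<le> ereal (real n)}" for n :: nat
  have closed: "closed (F n)" for n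
  proof -
    have "- F n = {v. ereal (real n) < G v}" by (auto simp: F_def)
    moreover have "open {v. ereal (real n) < G v}"
      using lsc unfolding lsc_fun_iff_eventually
      by (subst open_subopen) (fastforce simp: eventually_nhds)
    ultimately show ?thesis by (simp add: closed_def)
  qed
  have "edom G \<subseteq> \<Union>(range F)"
  proof
    fix v assume v: "v \<in> edom G"
    obtain n where "real_of_ereal (G v) \<le> real n" using real_arch_simple by blast
    then have "v \<in> F n" unfolding F_def by (subst mem_Collect_eq, subst edom_real[OF proper v]) simp
    then show "v \<in> \<Union>(range F)" by blast
  qed
  then have "y \<in> interior (\<Union>(range F))" using y interior_mono by blast
  moreover have "interior (\<Union>(range F)) = {}" if "\<And>n. interior (F n) = {}"
  proof -
    have "euclidean interior_of \<Union>(range F) = {}"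
      using closed that
      by (intro Baire_category_alt) (auto simp: completely_metrizable_space_euclidean)
    then show ?thesis by simp
  qed
  ultimately obtain n z where "z \<in> interior (F n)" by blast
  then obtain \<rho> where \<rho>: "0 < \<rho>" "ball z \<rho> \<subseteq> F n" by (auto simp: mem_interior)
  have sub: "F n \<subseteq> edom G" by (auto simp: F_def edom_def)
  have bnd: "real_of_ereal (G v) \<le> real n" if "v \<in> ball z \<rho>" for v
  proof -
    have v: "v \<in> F n" using that \<rho> by blast
    then have "G v \<le> ereal (real n)" by (simp add: F_def)
    then show ?thesis
      using v sub by (subst (asm) edom_real[OF proper]) auto
  qed
  have "ball z \<rho> \<subseteq> edom G" using \<rho>(2) sub by (rule order.trans)
  from convex_on_bounded_near_interior[OF convex_fun_imp_convex_on[OF proper conv] \<rho>(1) this bnd y]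
  show thesis using that by blast
qed

lemma interior_edom_subset_dom_subdiff:
  assumes G: "G \<in> Gamma_class"
  shows "interior (edom G) \<subseteq> dom_subdiff G"
proof
  fix y assume y: "y \<in> interior (edom G)"
  have proper: "proper_fun G" and conv: "convex_fun G"
    using G by (auto simp: Gamma_class_def)
  obtain r M where "0 < r" "ball y r \<subseteq> edom G" "\<And>v. v \<in> ball y r \<Longrightarrow> real_of_ereal (G v) \<le> M"
    using Gamma_class_bounded_near_interior[OF G y] by blast
  from locally_bounded_imp_calm[OF convex_fun_imp_convex_on[OF proper conv] this]
  obtain C where "0 \<le> C"
    "\<And>v. v \<in> edom G \<Longrightarrow> real_of_ereal (G y) - C * norm (v - y) \<le> real_of_ereal (G v)"
    by blast
  moreover have "y \<in> edom G" using y interior_subset by blast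
  ultimately show "y \<in> dom_subdiff G"
    unfolding dom_subdiff_iff_calm[OF proper conv] by blast
qed

lemma interior_dom_subdiff:
  assumes "G \<in> Gamma_class"
  shows "interior (dom_subdiff G) = interior (edom G)"
proof
  show "interior (dom_subdiff G) \<subseteq> interior (edom G)"
    using assms by (intro interior_mono dom_subdiff_subset_edom) (simp add: Gamma_class_def)
  show "interior (edom G) \<subseteq> interior (dom_subdiff G)"
    using interior_edom_subset_dom_subdiff[OF assms] by (intro interior_maximal) auto
qed

lemma gradient_in_subdiff:
  assumes G: "proper_fun G" "convex_fun G" and y: "frechet_differentiable_at G y"
  shows "gradient G y \<in> subdiff G y"
proof -
  define g where "g = (\<lambda>v. real_of_ereal (G v))"
  have der: "(g has_derivative frechet_derivative g (at y)) (at y)"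
    using y by (simp add: frechet_differentiable_at_def frechet_derivative_works g_def)
  have grad: "blinfun_apply (gradient G y) = frechet_derivative g (at y)"
    using has_derivative_bounded_linear[OF der]
    by (simp add: gradient_def bounded_linear_Blinfun_apply flip: g_def)
  have "\<bar>G y\<bar> \<noteq> \<infinity>"
    using y eventually_nhds_x_imp_x[of "\<lambda>v. \<bar>G v\<bar> \<noteq> \<infinity>" y]
    by (simp add: frechet_differentiable_at_def)
  then have yG: "y \<in> edom G" by (auto simp: edom_def)
  have g: "convex_on (edom G) g"
    unfolding g_def using G by (rule convex_fun_imp_convex_on)
  have "g y + blinfun_apply (gradient G y) (v - y) \<le> g v" if "v \<in> edom G" for v
    unfolding grad using g yG that der by (rule derivative_imp_subgradient)
  then show ?thesis using yG by (simp add: subdiff_iff[OF G(1)] g_def)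
qed

text \<open>
  If \<open>norm (\<eta> n) < Z\<close>, the subgradient inequality gives \<open>G (s n) \<le> G v + Z * norm (v - s n)\<close>.
  Lower semicontinuity passes this to the limit along the infinitely many such \<open>n\<close>, which
  makes \<open>G b\<close> finite and \<open>b\<close> a calm point with constant \<open>Z\<close>.
\<close>

lemma subgradients_bounded_imp_limit_in_dom_subdiff:
  assumes G: "G \<in> Gamma_class" and s: "s \<longlonglongrightarrow> b"
    and \<eta>: "\<And>n. \<eta> n \<in> subdiff G (s n)" and Z: "\<exists>\<^sub>F n in sequentially. norm (\<eta> n) < Z"
  shows "b \<in> dom_subdiff G"
proof -
  have proper: "proper_fun G" and conv: "convex_fun G" and lsc: "lsc_fun G"
    using G by (auto simp: Gamma_class_def)
  define g where "g v = real_of_ereal (G v)" for v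
  have *: "G b \<le> ereal (g v + Z * norm (v - b))" if v: "v \<in> edom G" for v
  proof (rule ccontr)
    assume "\<not> ?thesis"
    then have "ereal (g v + Z * norm (v - b)) < G b" by simp
    from ereal_dense2[OF this] obtain c where c: "g v + Z * norm (v - b) < c" "ereal c < G b"
      by auto
    have "\<forall>\<^sub>F n in sequentially. ereal c < G (s n)"
      using lsc c(2) s unfolding lsc_fun_iff_eventually filterlim_iff by blast
    moreover have "((\<lambda>n. g v + Z * norm (v - s n)) \<longlongrightarrow> g v + Z * norm (v - b)) sequentially"
      by (intro tendsto_intros s)
    then have "\<forall>\<^sub>F n in sequentially. g v + Z * norm (v - s n) < c"
      using c(1) by (rule order_tendstoD)
    ultimately have "\<forall>\<^sub>F n in sequentially. \<not> norm (\<eta> n) < Z"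
    proof eventually_elim
      case (elim n)
      have sn: "s n \<in> edom G" and le: "g (s n) + blinfun_apply (\<eta> n) (v - s n) \<le> g v"
        using \<eta>[of n] v by (auto simp: subdiff_iff[OF proper] g_def)
      have "c < g (s n)"
        using elim(1) by (subst (asm) edom_real[OF proper sn]) (simp add: g_def)
      then have "Z * norm (v - s n) < - blinfun_apply (\<eta> n) (v - s n)"
        using elim(2) le by linarith
      also have "\<dots> \<le> norm (\<eta> n) * norm (v - s n)"
        using norm_blinfun[of "\<eta> n" "v - s n"] by simp
      finally show ?case by (smt (verit) mult_right_mono norm_ge_zero)
    qed
    then show False using Z by (simp add: frequently_def)
  qed
  obtain v0 where "v0 \<in> edom G" using proper by (auto simp: proper_fun_def)
  then have b: "b \<in> edom G" using *[of v0] by (auto simp: edom_def)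
  have Z0: "0 \<le> Z" using frequently_ex[OF Z] by (smt (verit) norm_ge_zero)
  have "g b - Z * norm (v - b) \<le> g v" if "v \<in> edom G" for v
    using *[OF that] by (subst (asm) edom_real[OF proper b]) (simp add: g_def)
  then show ?thesis using b Z0 by (auto simp: dom_subdiff_iff_calm[OF proper conv] g_def)
qed


section \<open>Conjugates\<close>

lemma fenchel_young:
  assumes J: "proper_fun J" and x: "x \<in> edom J"
    and G: "proper_fun (conjugate J)" and \<eta>: "\<eta> \<in> edom (conjugate J)"
  shows "blinfun_apply \<eta> x - real_of_ereal (J x) \<le> real_of_ereal (conjugate J \<eta>)"
proof -
  have "ereal (blinfun_apply \<eta> x) - J x \<le> conjugate J \<eta>"
    unfolding conjugate_def by (rule SUP_upper) simp
  then show ?thesis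
    by (subst (asm) edom_real[OF G \<eta>], subst (asm) edom_real[OF J x]) simp
qed

lemma conjugate_near_maximizer:
  assumes J: "proper_fun J" and G: "proper_fun (conjugate J)"
    and \<eta>: "\<eta> \<in> edom (conjugate J)" and e: "0 < e"
  obtains x where "x \<in> edom J"
    "real_of_ereal (conjugate J \<eta>) < blinfun_apply \<eta> x - real_of_ereal (J x) + e"
proof -
  have "ereal (real_of_ereal (conjugate J \<eta>) - e) < ereal (real_of_ereal (conjugate J \<eta>))"
    using e by simp
  also have "\<dots> = (SUP x. ereal (blinfun_apply \<eta> x) - J x)"
    unfolding edom_real[OF G \<eta>, symmetric] by (rule conjugate_def)
  finally obtain x where
    x: "ereal (real_of_ereal (conjugate J \<eta>) - e) < ereal (blinfun_apply \<eta> x) - J x"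
    by (auto simp: less_SUP_iff)
  then have xJ: "x \<in> edom J" by (cases "J x") (auto simp: edom_def)
  from x have "real_of_ereal (conjugate J \<eta>) - e < blinfun_apply \<eta> x - real_of_ereal (J x)"
    by (subst (asm) edom_real[OF J xJ]) simp
  then show thesis using xJ by (intro that) auto
qed

lemma lsc_fun_conjugate: "lsc_fun (conjugate J)"
  unfolding lsc_fun_iff_eventually
proof (intro allI impI)
  fix \<xi> :: "'a \<Rightarrow>\<^sub>L real" and c assume "c < conjugate J \<xi>"
  then obtain x where x: "c < ereal (blinfun_apply \<xi> x) - J x"
    by (auto simp: conjugate_def less_SUP_iff)
  have "\<forall>\<^sub>F \<eta> in nhds \<xi>. c < ereal (blinfun_apply \<eta> x) - J x"
  proof (cases "J x")
    case (real a)
    have "((\<lambda>\<eta>. ereal (blinfun_apply \<eta> x - a)) \<longlongrightarrow> ereal (blinfun_apply \<xi> x - a)) (nhds \<xi>)"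
      by (intro tendsto_intros) (simp add: filterlim_ident)
    from order_tendstoD(1)[OF this, of c] show ?thesis using x real by simp
  qed (use x in auto)
  then show "\<forall>\<^sub>F \<eta> in nhds \<xi>. c < conjugate J \<eta>"
    by (rule eventually_mono) (auto simp: conjugate_def less_SUP_iff)
qed

lemma convex_fun_conjugate:
  assumes J: "proper_fun J"
  shows "convex_fun (conjugate J)"
  unfolding convex_fun_def
proof (intro allI impI)
  fix \<xi> \<eta> :: "'a \<Rightarrow>\<^sub>L real" and t :: real assume t: "0 < t" "t < 1"
  show "conjugate J ((1 - t) *\<^sub>R \<xi> + t *\<^sub>R \<eta>)
      \<le> ereal (1 - t) * conjugate J \<xi> + ereal t * conjugate J \<eta>"
    unfolding conjugate_def[of J "(1 - t) *\<^sub>R \<xi> + t *\<^sub>R \<eta>"]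
  proof (rule SUP_least)
    fix x
    have le: "ereal (blinfun_apply \<zeta> x) - J x \<le> conjugate J \<zeta>" for \<zeta>
      unfolding conjugate_def by (rule SUP_upper) simp
    show "ereal (blinfun_apply ((1 - t) *\<^sub>R \<xi> + t *\<^sub>R \<eta>) x) - J x
        \<le> ereal (1 - t) * conjugate J \<xi> + ereal t * conjugate J \<eta>"
    proof (cases "J x")
      case (real a)
      have "ereal (blinfun_apply ((1 - t) *\<^sub>R \<xi> + t *\<^sub>R \<eta>) x) - J x
          = ereal (1 - t) * (ereal (blinfun_apply \<xi> x) - J x)
            + ereal t * (ereal (blinfun_apply \<eta> x) - J x)"
        unfolding real blinfun.add_left blinfun.scaleR_left by (simp add: algebra_simps)
      also have "\<dots> \<le> ereal (1 - t) * conjugate J \<xi> + ereal t * conjugate J \<eta>"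
        using t le by (intro add_mono ereal_mult_left_mono) auto
      finally show ?thesis .
    next
      case PInf
      then show ?thesis by simp
    next
      case MInf
      then show ?thesis using J by (simp add: proper_fun_def)
    qed
  qed
qed

lemma proper_fun_conjugate:
  assumes J: "proper_fun J" and ne: "edom (conjugate J) \<noteq> {}"
  shows "proper_fun (conjugate J)"
  unfolding proper_fun_def
proof (intro conjI allI ne)
  fix \<eta>
  obtain x where x: "x \<in> edom J" using J by (auto simp: proper_fun_def)
  have "ereal (blinfun_apply \<eta> x) - J x \<le> conjugate J \<eta>"
    unfolding conjugate_def by (rule SUP_upper) simp
  then show "conjugate J \<eta> \<noteq> -\<infinity>"
    by (subst (asm) edom_real[OF J x]) auto
qed

lemma conjugate_in_Gamma_class:
  assumes "proper_fun J" "edom (conjugate J) \<noteq> {}"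
  shows "conjugate J \<in> Gamma_class"
  using assms
  by (simp add: Gamma_class_def lsc_fun_conjugate convex_fun_conjugate proper_fun_conjugate)

section \<open>Strong minima\<close>

text \<open>
  If no \<open>\<kappa>\<close> worked for some \<open>e\<close>, choosing a counterexample for each \<open>\<kappa> = 1 / (n + 1)\<close> would give
  a minimizing sequence that stays away from \<open>xb\<close>.
\<close>

lemma attains_strong_minD:
  assumes I: "proper_fun I" and min: "attains_strong_min I"
  obtains xb where "xb \<in> edom I" "\<And>x. x \<in> edom I \<Longrightarrow> real_of_ereal (I xb) \<le> real_of_ereal (I x)"
    "\<And>e. 0 < e \<Longrightarrow> \<exists>\<kappa>>0. \<forall>x\<in>edom I.
      real_of_ereal (I x) \<le> real_of_ereal (I xb) + \<kappa> \<longrightarrow> norm (x - xb) \<le> e"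
proof -
  obtain xb where le: "\<And>x. I xb \<le> I x"
    and conv: "\<And>s :: nat \<Rightarrow> 'a. (\<lambda>n. I (s n)) \<longlonglongrightarrow> (INF x. I x) \<Longrightarrow> s \<longlonglongrightarrow> xb"
    using min by (auto simp: attains_strong_min_def)
  have inf: "(INF x. I x) = I xb"
    using le by (intro antisym INF_lower INF_greatest) auto
  obtain x0 where "x0 \<in> edom I" using I by (auto simp: proper_fun_def)
  then have xb: "xb \<in> edom I" using le[of x0] by (auto simp: edom_def)
  have le_real: "real_of_ereal (I xb) \<le> real_of_ereal (I x)" if "x \<in> edom I" for x
    using le[of x] by (subst (asm) edom_real[OF I xb], subst (asm) edom_real[OF I that]) simp
  have "\<exists>\<kappa>>0. \<forall>x\<in>edom I. real_of_ereal (I x) \<le> real_of_ereal (I xb) + \<kappa> \<longrightarrow> norm (x - xb) \<le> e"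
    if e: "0 < e" for e
  proof (rule ccontr)
    assume "\<not> ?thesis"
    then have "\<exists>x\<in>edom I. real_of_ereal (I x) \<le> real_of_ereal (I xb) + inverse (Suc n)
        \<and> e < norm (x - xb)" for n
      by (metis inverse_positive_iff_positive not_le of_nat_0_less_iff zero_less_Suc)
    then obtain s where s: "\<And>n. s n \<in> edom I"
      "\<And>n. real_of_ereal (I (s n)) \<le> real_of_ereal (I xb) + inverse (Suc n)"
      "\<And>n. e < norm (s n - xb)" by metis
    have "(\<lambda>n. real_of_ereal (I (s n))) \<longlonglongrightarrow> real_of_ereal (I xb)"
    proof (rule tendsto_sandwich[OF _ _ tendsto_const])
      show "\<forall>\<^sub>F n in sequentially. real_of_ereal (I xb) \<le> real_of_ereal (I (s n))"
        using s(1) le_real by simp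
      show "\<forall>\<^sub>F n in sequentially. real_of_ereal (I (s n)) \<le> real_of_ereal (I xb) + inverse (Suc n)"
        using s(2) by (intro always_eventually allI)
      show "(\<lambda>n. real_of_ereal (I xb) + inverse (Suc n)) \<longlonglongrightarrow> real_of_ereal (I xb)"
        using tendsto_add[OF tendsto_const LIMSEQ_inverse_real_of_nat] by simp
    qed
    then have "(\<lambda>n. ereal (real_of_ereal (I (s n)))) \<longlonglongrightarrow> ereal (real_of_ereal (I xb))"
      by (rule tendsto_ereal)
    then have "(\<lambda>n. I (s n)) \<longlonglongrightarrow> (INF x. I x)"
      by (simp only: edom_real[OF I s(1), symmetric] edom_real[OF I xb, symmetric] inf)
    then have "s \<longlonglongrightarrow> xb" by (rule conv)
    then have "(\<lambda>n. norm (s n - xb)) \<longlonglongrightarrow> 0"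
      by (simp add: LIM_zero tendsto_norm_zero)
    from order_tendstoD(2)[OF this e] obtain n where "norm (s n - xb) < e"
      by (auto simp: eventually_sequentially)
    then show False using s(3)[of n] by simp
  qed
  then show thesis using that xb le_real by blast
qed

text \<open>
  The criterion of Furi and Vignoli: if the diameters of the sublevel sets shrink to \<open>0\<close> as the
  level decreases to the infimum \<open>m\<close>, then every minimizing sequence is Cauchy, its limit is a
  minimum point by lower semicontinuity, and there is only one minimum point.
\<close>

lemma attains_strong_minI:
  fixes I :: "'a::banach \<Rightarrow> ereal"
  assumes I: "proper_fun I" "lsc_fun I"
    and lower: "\<And>x. x \<in> edom I \<Longrightarrow> m \<le> real_of_ereal (I x)"
    and approx: "\<And>\<kappa>. 0 < \<kappa> \<Longrightarrow> \<exists>x\<in>edom I. real_of_ereal (I x) < m + \<kappa>"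
    and diam: "\<And>e. 0 < e \<Longrightarrow> \<exists>\<kappa>>0. \<forall>x\<in>edom I. \<forall>y\<in>edom I.
      real_of_ereal (I x) < m + \<kappa> \<longrightarrow> real_of_ereal (I y) < m + \<kappa> \<longrightarrow> norm (x - y) \<le> e"
  shows "attains_strong_min I"
proof -
  have sublevel: "x \<in> edom I \<and> real_of_ereal (I x) < c" if "I x < ereal c" for x c
  proof
    show x: "x \<in> edom I" using that by (auto simp: edom_def)
    show "real_of_ereal (I x) < c"
      using that by (subst (asm) edom_real[OF I(1) x]) simp
  qed
  have Cauchy: "Cauchy s" if s: "(\<lambda>n. I (s n)) \<longlonglongrightarrow> ereal m" for s :: "nat \<Rightarrow> 'a"
  proof (rule metric_CauchyI)
    fix e :: real assume e: "0 < e"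
    obtain \<kappa> where \<kappa>: "0 < \<kappa>" "\<And>x y. x \<in> edom I \<Longrightarrow> y \<in> edom I \<Longrightarrow> real_of_ereal (I x) < m + \<kappa>
        \<Longrightarrow> real_of_ereal (I y) < m + \<kappa> \<Longrightarrow> norm (x - y) \<le> e / 2"
      using diam[of "e / 2"] e by auto
    have "\<forall>\<^sub>F n in sequentially. I (s n) < ereal (m + \<kappa>)"
      using order_tendstoD(2)[OF s] \<kappa>(1) by simp
    then obtain N where "\<And>n. N \<le> n \<Longrightarrow> I (s n) < ereal (m + \<kappa>)"
      by (auto simp: eventually_sequentially)
    then have "dist (s i) (s j) < e" if "N \<le> i" "N \<le> j" for i j
      using \<kappa>(2)[of "s i" "s j"] sublevel that e by (fastforce simp: dist_norm)
    then show "\<exists>M. \<forall>i\<ge>M. \<forall>j\<ge>M. dist (s i) (s j) < e" by blast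
  qed
  have limit: "I x = ereal m" if s: "(\<lambda>n. I (s n)) \<longlonglongrightarrow> ereal m" "s \<longlonglongrightarrow> x"
    for s :: "nat \<Rightarrow> 'a" and x
  proof (rule antisym)
    show "I x \<le> ereal m"
    proof (rule ccontr)
      assume "\<not> ?thesis"
      then have "ereal m < I x" by simp
      from ereal_dense2[OF this] obtain c where c: "ereal m < ereal c" "ereal c < I x"
        by blast
      have "\<forall>\<^sub>F n in sequentially. ereal c < I (s n)"
        using I(2) c(2) s(2) unfolding lsc_fun_iff_eventually filterlim_iff by blast
      moreover have "\<forall>\<^sub>F n in sequentially. I (s n) < ereal c"
        using order_tendstoD(2)[OF s(1) c(1)] .
      ultimately have "\<forall>\<^sub>F n in sequentially. False" by eventually_elim simp
      then show False by simp
    qed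
    then have x: "x \<in> edom I" by (auto simp: edom_def)
    show "ereal m \<le> I x" by (subst edom_real[OF I(1) x]) (simp add: lower[OF x])
  qed
  have ge: "ereal m \<le> I x" for x
  proof (cases "x \<in> edom I")
    case True
    show ?thesis by (subst edom_real[OF I(1) True]) (simp add: lower[OF True])
  qed (simp add: edom_def)
  have "\<forall>n. \<exists>x\<in>edom I. real_of_ereal (I x) < m + inverse (Suc n)"
    using approx by simp
  then obtain s where s: "\<And>n. s n \<in> edom I" "\<And>n. real_of_ereal (I (s n)) < m + inverse (Suc n)"
    by metis
  have "(\<lambda>n. real_of_ereal (I (s n))) \<longlonglongrightarrow> m"
  proof (rule tendsto_sandwich[OF _ _ tendsto_const])
    show "\<forall>\<^sub>F n in sequentially. m \<le> real_of_ereal (I (s n))"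
      using s(1) lower by simp
    show "\<forall>\<^sub>F n in sequentially. real_of_ereal (I (s n)) \<le> m + inverse (Suc n)"
      using s(2) by (intro always_eventually allI less_imp_le)
    show "(\<lambda>n. m + inverse (Suc n)) \<longlonglongrightarrow> m"
      using tendsto_add[OF tendsto_const LIMSEQ_inverse_real_of_nat] by simp
  qed
  then have "(\<lambda>n. ereal (real_of_ereal (I (s n)))) \<longlonglongrightarrow> ereal m"
    by (rule tendsto_ereal)
  then have sm: "(\<lambda>n. I (s n)) \<longlonglongrightarrow> ereal m"
    by (simp only: edom_real[OF I(1) s(1), symmetric])
  obtain xb where "s \<longlonglongrightarrow> xb" using Cauchy[OF sm] convergent_def Cauchy_convergent by blast
  then have xb: "I xb = ereal m" using sm by (rule limit[rotated])
  have inf: "(INF x. I x) = ereal m"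
    using xb ge by (intro antisym INF_greatest INF_lower2[of xb]) auto
  have "r \<longlonglongrightarrow> xb" if r: "(\<lambda>n. I (r n)) \<longlonglongrightarrow> ereal m" for r :: "nat \<Rightarrow> 'a"
  proof -
    obtain x where rx: "r \<longlonglongrightarrow> x" using Cauchy[OF r] convergent_def Cauchy_convergent by blast
    have x: "I x = ereal m" using r rx by (rule limit)
    have "norm (x - xb) \<le> e" if "0 < e" for e
      using diam[OF that] x xb by (auto simp: edom_def)
    from field_le_epsilon[of "norm (x - xb)" 0] this have "norm (x - xb) \<le> 0" by simp
    then show ?thesis using rx by simp
  qed
  then show ?thesis
    unfolding attains_strong_min_def inf using ge by (intro exI[of _ xb]) (simp add: xb)
qed

lemma edom_tilt [simp]: "edom (\<lambda>x. J x - ereal (f x)) = edom J"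
proof -
  have "J x - ereal (f x) < \<infinity> \<longleftrightarrow> J x < \<infinity>" for x by (cases "J x") auto
  then show ?thesis by (simp add: edom_def)
qed

lemma proper_fun_tilt:
  assumes J: "proper_fun J"
  shows "proper_fun (\<lambda>x. J x - ereal (f x))"
proof -
  have "J x - ereal (f x) \<noteq> -\<infinity>" for x using J by (cases "J x") (auto simp: proper_fun_def)
  then show ?thesis using J by (simp add: proper_fun_def)
qed

lemma real_tilt:
  assumes J: "proper_fun J" and x: "x \<in> edom J"
  shows "real_of_ereal (J x - ereal c) = real_of_ereal (J x) - c"
  by (subst edom_real[OF J x]) simp

lemma lsc_fun_tilt:
  assumes J: "lsc_fun J" and f: "\<And>x. f \<midarrow>x\<rightarrow> f x"
  shows "lsc_fun (\<lambda>x. J x - ereal (f x))"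
  unfolding lsc_fun_iff_eventually
proof (intro allI impI)
  fix x c assume "c < J x - ereal (f x)"
  from ereal_dense2[OF this] obtain a where a: "c < ereal a" "ereal a < J x - ereal (f x)"
    by blast
  have "ereal (a + f x) < J x" using a(2) by (cases "J x") auto
  from ereal_dense2[OF this] obtain b where b: "a + f x < b" "ereal b < J x" by auto
  have "\<forall>\<^sub>F y in nhds x. ereal b < J y"
    using J b(2) unfolding lsc_fun_iff_eventually by blast
  moreover have "(f \<longlongrightarrow> f x) (nhds x)" using f[of x] by (simp add: tendsto_at_iff_tendsto_nhds)
  then have "((\<lambda>y. a + f y) \<longlongrightarrow> a + f x) (nhds x)" by (intro tendsto_intros)
  then have "\<forall>\<^sub>F y in nhds x. a + f y < b" using b(1) by (rule order_tendstoD)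
  ultimately show "\<forall>\<^sub>F y in nhds x. c < J y - ereal (f y)"
  proof eventually_elim
    case (elim y)
    have "ereal a < J y - ereal (f y)" using elim by (cases "J y") auto
    with a(1) show ?case by (rule less_trans)
  qed
qed


section \<open>Strong minima and Frechet differentiability of the conjugate\<close>

text \<open>
  The derivative is evaluation at the minimum point \<open>xb\<close>. For \<open>\<eta> = \<xi> + h\<close>, the conjugate at \<open>\<eta>\<close> is
  almost attained at some \<open>x\<close>, with a tolerance proportional to \<open>norm h\<close>, and the error in the linear
  approximation is then at most \<open>h (x - xb)\<close> up to that tolerance. It remains to see that \<open>x\<close> is
  close to \<open>xb\<close>, and for this that \<open>x\<close> almost minimizes \<open>J - \<xi>\<close>, which comes down to \<open>h x\<close> being
  small. As the conjugate is at most \<open>M\<close> on a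
  ball around \<open>\<xi>\<close>, going from \<open>\<xi>\<close> in the direction of \<open>h\<close> to a fixed distance
  bounds \<open>h x\<close> by a multiple of \<open>norm h\<close>.
\<close>

lemma strong_min_imp_frechet_differentiable:
  fixes J :: "'a::banach \<Rightarrow> ereal"
  assumes J: "proper_fun J" and \<xi>: "\<xi> \<in> interior (edom (conjugate J))"
    and min: "attains_strong_min (\<lambda>x. J x - ereal (blinfun_apply \<xi> x))"
  shows "frechet_differentiable_at (conjugate J) \<xi>"
proof -
  define g where "g = (\<lambda>\<eta>. real_of_ereal (conjugate J \<eta>))"
  define j where "j x = real_of_ereal (J x)" for x
  have Gam: "conjugate J \<in> Gamma_class"
    using J \<xi> interior_subset by (intro conjugate_in_Gamma_class) auto
  then have G: "proper_fun (conjugate J)" by (simp add: Gamma_class_def)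
  have FY: "blinfun_apply \<eta> x - j x \<le> g \<eta>" if "x \<in> edom J" "\<eta> \<in> edom (conjugate J)" for \<eta> x
    unfolding g_def j_def using J that(1) G that(2) by (rule fenchel_young)
  obtain xb where xb: "xb \<in> edom J"
    and xb_min: "\<And>x. x \<in> edom J \<Longrightarrow> j xb - blinfun_apply \<xi> xb \<le> j x - blinfun_apply \<xi> x"
    and xb_strong: "\<And>e. 0 < e \<Longrightarrow> \<exists>\<kappa>>0. \<forall>x\<in>edom J.
      j x - blinfun_apply \<xi> x \<le> j xb - blinfun_apply \<xi> xb + \<kappa> \<longrightarrow> norm (x - xb) \<le> e"
    using attains_strong_minD[OF proper_fun_tilt[OF J] min]
    by (simp add: real_tilt[OF J] j_def cong: ball_cong) blast
  have \<xi>_dom: "\<xi> \<in> edom (conjugate J)" using \<xi> interior_subset by blast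
  have g\<xi>: "g \<xi> = blinfun_apply \<xi> xb - j xb"
  proof (rule antisym)
    show "g \<xi> \<le> blinfun_apply \<xi> xb - j xb"
    proof (rule field_le_epsilon)
      fix e :: real assume "0 < e"
      from conjugate_near_maximizer[OF J G \<xi>_dom this]
      obtain x where "x \<in> edom J" "g \<xi> < blinfun_apply \<xi> x - j x + e"
        unfolding g_def j_def by blast
      then show "g \<xi> \<le> blinfun_apply \<xi> xb - j xb + e" using xb_min[of x] by simp
    qed
  qed (rule FY[OF xb \<xi>_dom])
  obtain r M where r: "0 < r" "ball \<xi> r \<subseteq> edom (conjugate J)"
    and M: "\<And>\<eta>. \<eta> \<in> ball \<xi> r \<Longrightarrow> g \<eta> \<le> M"
    using Gamma_class_bounded_near_interior[OF Gam \<xi>] unfolding g_def by blast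
  have "(g has_derivative (\<lambda>h. blinfun_apply h xb)) (at \<xi>)"
    unfolding has_derivative_within_alt2
  proof (intro conjI allI impI)
    show "bounded_linear (\<lambda>h. blinfun_apply h xb)" by (rule blinfun.bounded_linear_left)
    fix e :: real assume e: "0 < e"
    obtain \<kappa> where \<kappa>: "0 < \<kappa>" "\<And>x. x \<in> edom J \<Longrightarrow>
        j x - blinfun_apply \<xi> x \<le> j xb - blinfun_apply \<xi> xb + \<kappa> \<Longrightarrow> norm (x - xb) \<le> e / 2"
      using xb_strong[of "e / 2"] e by auto
    (* Below, h x \<le> 4 * K / r * norm h, and x minimizes J - \<xi> up to L * norm h. *)
    define K where "K = M - g \<xi> + norm xb + e / 2"
    have K: "0 < K" using M[of \<xi>] r(1) e by (simp add: K_def add_nonneg_pos)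
    define L where "L = 4 * K / r + norm xb + e / 2"
    have "0 < 4 * K / r" using K r by simp
    then have L: "0 < L" using e norm_ge_zero[of xb] unfolding L_def by linarith
    have main: "norm (g \<eta> - g \<xi> - blinfun_apply (\<eta> - \<xi>) xb) \<le> e * norm (\<eta> - \<xi>)"
      if \<eta>: "\<eta> \<noteq> \<xi>" "dist \<eta> \<xi> < min (r / 4) (min 1 (\<kappa> / L))" for \<eta>
    proof -
      define h where "h = \<eta> - \<xi>"
      define n where "n = norm h"
      have \<eta>h: "\<eta> = \<xi> + h" by (simp add: h_def)
      have n: "0 < n" "n < r / 4" "n < 1" "n * L < \<kappa>"
        using \<eta> L by (auto simp: n_def h_def dist_norm field_simps)
      have "\<eta> \<in> ball \<xi> r" using \<eta> r by (simp add: dist_commute)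
      then have \<eta>_dom: "\<eta> \<in> edom (conjugate J)" using r by blast
      have "0 < e / 2 * n" using e n by simp
      from conjugate_near_maximizer[OF J G \<eta>_dom this]
      obtain x where x: "x \<in> edom J" "g \<eta> < blinfun_apply \<eta> x - j x + e / 2 * n"
        unfolding g_def j_def by blast
      have low: "g \<xi> + blinfun_apply h xb \<le> g \<eta>"
        using FY[OF xb \<eta>_dom] by (simp add: g\<xi> \<eta>h blinfun.add_left)
      have hxb: "\<bar>blinfun_apply h xb\<bar> \<le> n * norm xb"
        using norm_blinfun[of h xb] by (simp add: n_def)
      (* Moving further in the direction h, up to distance r / 2, keeps the conjugate below M. *)
      have "\<xi> + (r / (2 * n)) *\<^sub>R h \<in> ball \<xi> r" using n r(1) by (simp add: dist_norm n_def)
      then have u: "blinfun_apply \<xi> x + r / (2 * n) * blinfun_apply h x - j x \<le> M"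
        using FY[OF x(1)] M r(2) by (fastforce simp: blinfun.add_left blinfun.scaleR_left)
      have hx: "blinfun_apply h x \<le> 4 * K / r * n"
      proof (cases "blinfun_apply h x \<le> 0")
        case True
        also have "0 \<le> 4 * K / r * n" using K r n by simp
        finally show ?thesis .
      next
        case False
        have "r / (4 * n) \<le> r / (2 * n) - 1" using n by (simp add: field_simps)
        then have "r / (4 * n) * blinfun_apply h x \<le> (r / (2 * n) - 1) * blinfun_apply h x"
          using False by (intro mult_right_mono) auto
        also have "\<dots> \<le> M - g \<xi> - blinfun_apply h xb + e / 2 * n"
          using u x(2) low by (simp add: \<eta>h blinfun.add_left left_diff_distrib)
        also have "\<dots> \<le> K"
        proof -
          have "n * norm xb \<le> norm xb" "e / 2 * n \<le> e / 2"
            using n e by (auto simp: mult_left_le_one_le mult_right_le_one_le)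
          then show ?thesis using hxb by (simp add: K_def)
        qed
        finally show ?thesis using n r by (simp add: field_simps)
      qed
      have "j x - blinfun_apply \<xi> x
          \<le> j xb - blinfun_apply \<xi> xb + (blinfun_apply h x - blinfun_apply h xb + e / 2 * n)"
        using x(2) low by (simp add: \<eta>h blinfun.add_left g\<xi>)
      also have "\<dots> \<le> j xb - blinfun_apply \<xi> xb + n * L"
        using hx hxb by (simp add: L_def algebra_simps)
      finally have "norm (x - xb) \<le> e / 2" using \<kappa>(2)[OF x(1)] n(4) by simp
      then have "n * norm (x - xb) \<le> n * (e / 2)" using n by (intro mult_left_mono) auto
      then have "blinfun_apply h x - blinfun_apply h xb \<le> n * (e / 2)"
        using norm_blinfun[of h "x - xb"] by (simp add: blinfun.diff_right n_def)
      then have "g \<eta> - g \<xi> - blinfun_apply h xb \<le> e * n"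
        using x(2) FY[OF x(1) \<xi>_dom] by (simp add: \<eta>h blinfun.add_left mult.commute[of n e])
      then show ?thesis using low by (simp add: h_def n_def)
    qed
    show "\<forall>\<^sub>F \<eta> in at \<xi>. norm (g \<eta> - g \<xi> - blinfun_apply (\<eta> - \<xi>) xb) \<le> e * norm (\<eta> - \<xi>)"
      unfolding eventually_at using main r(1) \<kappa>(1) L
      by (intro exI[of _ "min (r / 4) (min 1 (\<kappa> / L))"]) auto
  qed
  moreover have "\<forall>\<^sub>F \<eta> in nhds \<xi>. \<bar>conjugate J \<eta>\<bar> \<noteq> \<infinity>"
  proof -
    have "\<bar>conjugate J \<eta>\<bar> \<noteq> \<infinity>" if "\<eta> \<in> ball \<xi> r" for \<eta>
      using edom_real[OF G subsetD[OF r(2) that]] by (metis abs_ereal.simps(1) PInfty_neq_ereal(1))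
    moreover have "\<xi> \<in> ball \<xi> r" using r by simp
    ultimately show ?thesis unfolding eventually_nhds by (intro exI[of _ "ball \<xi> r"]) auto
  qed
  ultimately show ?thesis
    unfolding frechet_differentiable_at_def g_def by (blast intro: differentiableI)
qed

text \<open>
  If \<open>x\<close> minimizes \<open>J - \<xi>\<close> up to \<open>\<kappa>\<close>, then \<open>h x - \<kappa>\<close> is at most the increment of the conjugate from
  \<open>\<xi>\<close> to \<open>\<xi> + h\<close>, which differs from \<open>D h\<close> by at most a small multiple of \<open>norm h\<close>. Adding this for
  \<open>x\<close> and \<open>h\<close> and for \<open>y\<close> and \<open>- h\<close> cancels \<open>D\<close> and bounds \<open>h (x - y)\<close>. With \<open>h\<close> a multiple of a
  functional that norms \<open>x - y\<close>, the near minimizers are seen to form a set of small diameter.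
\<close>

lemma frechet_differentiable_imp_strong_min:
  fixes J :: "'a::banach \<Rightarrow> ereal"
  assumes J: "proper_fun J" "lsc_fun J"
    and diff: "frechet_differentiable_at (conjugate J) \<xi>"
  shows "attains_strong_min (\<lambda>x. J x - ereal (blinfun_apply \<xi> x))"
proof -
  define g where "g = (\<lambda>\<eta>. real_of_ereal (conjugate J \<eta>))"
  define j where "j x = real_of_ereal (J x)" for x
  obtain D where D: "(g has_derivative D) (at \<xi>)"
    using diff by (auto simp: frechet_differentiable_at_def differentiable_def g_def)
  have "\<forall>\<^sub>F \<eta> in nhds \<xi>. \<eta> \<in> edom (conjugate J)"
    using diff unfolding frechet_differentiable_at_def
    by (auto simp: edom_def elim: eventually_mono)
  then obtain \<rho> where \<rho>: "0 < \<rho>" "\<And>\<eta>. dist \<eta> \<xi> < \<rho> \<Longrightarrow> \<eta> \<in> edom (conjugate J)"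
    by (auto simp: eventually_nhds_metric)
  have \<xi>_dom: "\<xi> \<in> edom (conjugate J)" using \<rho> by simp
  then have G: "proper_fun (conjugate J)" using J by (intro proper_fun_conjugate) auto
  have FY: "blinfun_apply \<eta> x - j x \<le> g \<eta>" if "x \<in> edom J" "\<eta> \<in> edom (conjugate J)" for \<eta> x
    unfolding g_def j_def using J(1) that(1) G that(2) by (rule fenchel_young)
  have tilt: "real_of_ereal (J x - ereal (blinfun_apply \<xi> x)) = j x - blinfun_apply \<xi> x"
    if "x \<in> edom J" for x
    unfolding j_def using J(1) that by (rule real_tilt)
  show ?thesis
  proof (rule attains_strong_minI[where m = "- g \<xi>"], unfold edom_tilt)
    show "proper_fun (\<lambda>x. J x - ereal (blinfun_apply \<xi> x))"
      using J(1) by (rule proper_fun_tilt)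
    show "lsc_fun (\<lambda>x. J x - ereal (blinfun_apply \<xi> x))"
      using J(2) by (rule lsc_fun_tilt) (intro tendsto_intros)
    show "- g \<xi> \<le> real_of_ereal (J x - ereal (blinfun_apply \<xi> x))" if "x \<in> edom J" for x
      using FY[OF that \<xi>_dom] by (simp add: tilt[OF that])
    show "\<exists>x\<in>edom J. real_of_ereal (J x - ereal (blinfun_apply \<xi> x)) < - g \<xi> + \<kappa>"
      if "0 < \<kappa>" for \<kappa>
    proof -
      obtain x where x: "x \<in> edom J" "g \<xi> < blinfun_apply \<xi> x - j x + \<kappa>"
        unfolding g_def j_def using conjugate_near_maximizer[OF J(1) G \<xi>_dom \<open>0 < \<kappa>\<close>] by blast
      then show ?thesis by (intro bexI[of _ x]) (auto simp: tilt)
    qed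
    fix e :: real assume e: "0 < e"
    obtain d where d: "0 < d" "\<And>\<eta>. norm (\<eta> - \<xi>) < d \<Longrightarrow>
        norm (g \<eta> - g \<xi> - D (\<eta> - \<xi>)) \<le> e / 4 * norm (\<eta> - \<xi>)"
      using D e unfolding has_derivative_within_alt
      by (metis UNIV_I divide_pos_pos zero_less_numeral)
    define \<delta> where "\<delta> = min d \<rho> / 2"
    have \<delta>: "0 < \<delta>" "\<delta> < d" "\<delta> < \<rho>" using d(1) \<rho>(1) by (auto simp: \<delta>_def)
    (* With this \<kappa>, the bound 2 * (\<kappa> + e / 4 * \<delta>) on \<delta> * norm (x - y) found below is \<delta> * e. *)
    define \<kappa> where "\<kappa> = e * \<delta> / 4"
    have \<kappa>: "0 < \<kappa>" using e \<delta> by (simp add: \<kappa>_def)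
    have D_minus: "D (- h) = - D h" for h
      using linear_neg[OF has_derivative_linear[OF D]] .
    have near: "blinfun_apply h x - D h \<le> \<kappa> + e / 4 * \<delta>"
      if x: "x \<in> edom J" "j x - blinfun_apply \<xi> x < - g \<xi> + \<kappa>" and h: "norm h \<le> \<delta>" for x h
    proof -
      have "blinfun_apply (\<xi> + h) x - j x \<le> g (\<xi> + h)"
        using h \<delta> by (intro FY x(1) \<rho>(2)) (simp add: dist_norm)
      moreover have "g (\<xi> + h) - g \<xi> - D h \<le> e / 4 * norm h"
        using d(2)[of "\<xi> + h"] abs_ge_self[of "g (\<xi> + h) - g \<xi> - D h"] h \<delta>
        by (simp only: add_diff_cancel_left' real_norm_def) linarith
      moreover have "e / 4 * norm h \<le> e / 4 * \<delta>" using h e by simp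
      ultimately show ?thesis using x(2) by (simp add: blinfun.add_left)
    qed
    have "norm (x - y) \<le> e"
      if x: "x \<in> edom J" "j x - blinfun_apply \<xi> x < - g \<xi> + \<kappa>"
        and y: "y \<in> edom J" "j y - blinfun_apply \<xi> y < - g \<xi> + \<kappa>" for x y
    proof -
      obtain f :: "'a \<Rightarrow>\<^sub>L real" where f: "norm f \<le> 1" "blinfun_apply f (x - y) = norm (x - y)"
        by (rule norming_functional)
      have "norm (\<delta> *\<^sub>R f) \<le> \<delta>" using f(1) \<delta> by (simp add: mult_left_le)
      then have "blinfun_apply (\<delta> *\<^sub>R f) x - blinfun_apply (\<delta> *\<^sub>R f) y \<le> 2 * (\<kappa> + e / 4 * \<delta>)"
        using near[OF x, of "\<delta> *\<^sub>R f"] near[OF y, of "- (\<delta> *\<^sub>R f)"] D_minus[of "\<delta> *\<^sub>R f"]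
        by (simp add: blinfun.minus_left algebra_simps)
      then have "\<delta> * norm (x - y) \<le> \<delta> * e"
        by (simp add: f(2)[symmetric] blinfun.scaleR_left blinfun.diff_right \<kappa>_def algebra_simps)
      then show ?thesis using \<delta> by simp
    qed
    then show "\<exists>\<kappa>>0. \<forall>x\<in>edom J. \<forall>y\<in>edom J.
        real_of_ereal (J x - ereal (blinfun_apply \<xi> x)) < - g \<xi> + \<kappa> \<longrightarrow>
        real_of_ereal (J y - ereal (blinfun_apply \<xi> y)) < - g \<xi> + \<kappa> \<longrightarrow> norm (x - y) \<le> e"
      using \<kappa> by (intro exI[of _ \<kappa>]) (simp add: tilt)
  qed
qed

section \<open>Openness of the subdifferential domain and blow-up of gradients\<close>

lemma convex_segment_to_interior:
  fixes D :: "'b::real_normed_vector set"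
  assumes D: "convex D" and b: "b \<in> D" and r: "0 < r" "ball u r \<subseteq> D" and t: "0 < t" "t \<le> 1"
  shows "b + t *\<^sub>R (u - b) \<in> interior D"
  unfolding mem_interior
proof (intro exI conjI subsetI)
  show "0 < t * r" using t r by simp
  fix v assume v: "v \<in> ball (b + t *\<^sub>R (u - b)) (t * r)"
  define w where "w = (1 / t) *\<^sub>R (v - (b + t *\<^sub>R (u - b)))"
  have "norm w = norm (v - (b + t *\<^sub>R (u - b))) / t" using t by (simp add: w_def)
  also have "\<dots> < r" using v t by (simp add: dist_norm norm_minus_commute pos_divide_less_eq mult.commute)
  finally have "norm w < r" .
  then have "u + w \<in> D" using r(2) by (auto simp: dist_norm)
  then have "(1 - t) *\<^sub>R b + t *\<^sub>R (u + w) \<in> D" using D b t unfolding convex_alt by auto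
  also have "(1 - t) *\<^sub>R b + t *\<^sub>R (u + w) = v"
    using t by (simp add: w_def algebra_simps)
  finally show "v \<in> D" .
qed

text \<open>
  A point \<open>b\<close> with a subgradient that is not interior lies on the frontier of the domain.
  Along the segment from \<open>b\<close> to an interior point \<open>u\<close> the gradients are bounded, because the
  function is calm at \<open>b\<close> and bounded above near \<open>u\<close>; but they tend to infinity at \<open>b\<close>.
\<close>

lemma essentially_frechet_imp_dom_subdiff_eq:
  fixes G :: "'b::banach \<Rightarrow> ereal"
  assumes G: "essentially_frechet_differentiable G"
  shows "dom_subdiff G = interior (edom G)"
proof
  have Gam: "G \<in> Gamma_class" using G by (simp add: essentially_frechet_differentiable_def)
  then have proper: "proper_fun G" and conv: "convex_fun G" by (auto simp: Gamma_class_def)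
  show "interior (edom G) \<subseteq> dom_subdiff G" using Gam by (rule interior_edom_subset_dom_subdiff)
  define g where "g v = real_of_ereal (G v)" for v
  obtain u where "u \<in> interior (edom G)"
    using G interior_dom_subdiff[OF Gam] by (auto simp: essentially_frechet_differentiable_def)
  from Gamma_class_bounded_near_interior[OF Gam this]
  obtain r M where r: "0 < r" "ball u r \<subseteq> edom G" and M: "\<And>v. v \<in> ball u r \<Longrightarrow> g v \<le> M"
    unfolding g_def by blast
  show "dom_subdiff G \<subseteq> interior (edom G)"
  proof (rule subsetI, rule ccontr)
    fix b assume b_dom: "b \<in> dom_subdiff G" and b_int: "b \<notin> interior (edom G)"
    obtain C where b: "b \<in> edom G" and C: "0 \<le> C"
      and calm: "\<And>v. v \<in> edom G \<Longrightarrow> g b - C * norm (v - b) \<le> g v"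
      using b_dom unfolding dom_subdiff_iff_calm[OF proper conv] g_def by blast
    define t where "t n = inverse (real (Suc n))" for n
    define s where "s n = b + t n *\<^sub>R (u - b)" for n
    have t: "0 < t n" "t n \<le> 1" for n by (auto simp: t_def inverse_le_1_iff)
    have s_int: "s n \<in> interior (edom G)" for n
      unfolding s_def
      using convex_on_imp_convex[OF convex_fun_imp_convex_on[OF proper conv]] b r t
      by (rule convex_segment_to_interior)
    have "t \<longlonglongrightarrow> 0" unfolding t_def by (rule LIMSEQ_inverse_real_of_nat)
    then have "s \<longlonglongrightarrow> b + 0 *\<^sub>R (u - b)" unfolding s_def by (intro tendsto_intros)
    then have s_lim: "s \<longlonglongrightarrow> b" by simp
    have "b \<in> frontier (edom G)"
      using b b_int closure_subset by (auto simp: frontier_def)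
    then have "filterlim (\<lambda>n. norm (gradient G (s n))) at_top sequentially"
      using G s_int s_lim unfolding essentially_frechet_differentiable_def by blast
    then have "\<forall>\<^sub>F n in sequentially.
        2 * (M - g b + 2 * C * norm (u - b)) / r < norm (gradient G (s n))"
      by (simp add: filterlim_at_top_dense)
    then obtain n where n: "2 * (M - g b + 2 * C * norm (u - b)) / r < norm (gradient G (s n))"
      by (auto simp: eventually_sequentially)
    have "frechet_differentiable_at G (s n)"
      using G s_int unfolding essentially_frechet_differentiable_def interior_dom_subdiff[OF Gam]
      by blast
    then have "gradient G (s n) \<in> subdiff G (s n)"
      by (rule gradient_in_subdiff[OF proper conv])
    then have "g (s n) + blinfun_apply (gradient G (s n)) (v - s n) \<le> g v" if "v \<in> edom G" for v
      using that by (simp add: subdiff_iff[OF proper] g_def)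
    moreover have "s n \<in> edom G" using s_int interior_subset by blast
    ultimately have "norm (gradient G (s n)) \<le> 2 * (M - g b + 2 * C * norm (u - b)) / r"
      using subgradients_bounded_along_segment[OF r M b C calm t(1)[of n] t(2)[of n] s_def[of n]]
      by blast
    then show False using n by simp
  qed
qed

text \<open>
  Otherwise the gradients are bounded along a subsequence, so \<open>b\<close> has a subgradient and is
  therefore an interior point.
\<close>

lemma gradients_blow_up_if_dom_subdiff_open:
  fixes G :: "'b::banach \<Rightarrow> ereal" and s :: "nat \<Rightarrow> 'b"
  assumes Gam: "G \<in> Gamma_class" and op: "open (dom_subdiff G)"
    and diff: "\<And>y. y \<in> interior (edom G) \<Longrightarrow> frechet_differentiable_at G y"
    and s: "\<And>n. s n \<in> interior (edom G)" "s \<longlonglongrightarrow> b" and b: "b \<in> frontier (edom G)"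
  shows "filterlim (\<lambda>n. norm (gradient G (s n))) at_top sequentially"
proof (rule ccontr)
  have proper: "proper_fun G" and conv: "convex_fun G" using Gam by (auto simp: Gamma_class_def)
  assume "\<not> ?thesis"
  then obtain Z where "\<exists>\<^sub>F n in sequentially. norm (gradient G (s n)) < Z"
    by (auto simp: filterlim_at_top frequently_def not_less)
  moreover have "gradient G (s n) \<in> subdiff G (s n)" for n
    using diff[OF s(1)] by (rule gradient_in_subdiff[OF proper conv])
  ultimately have "b \<in> dom_subdiff G"
    by (intro subgradients_bounded_imp_limit_in_dom_subdiff[OF Gam s(2)])
  then have "b \<in> interior (edom G)"
    using interior_dom_subdiff[OF Gam] op by (simp add: interior_open)
  then show False using b by (simp add: frontier_def)
qed

theorem proposition3:
  fixes J :: "'a::banach \<Rightarrow> ereal"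
  assumes "proper_fun J"
    and "lsc_fun J"
  shows "strongly_adequate J \<longleftrightarrow> essentially_frechet_differentiable (conjugate J)"
proof
  assume sa: "strongly_adequate J"
  then have ne: "dom_subdiff (conjugate J) \<noteq> {}" and op: "open (dom_subdiff (conjugate J))"
    and min: "\<And>\<xi>. \<xi> \<in> dom_subdiff (conjugate J) \<Longrightarrow>
      attains_strong_min (\<lambda>x. J x - ereal (blinfun_apply \<xi> x))"
    by (auto simp: strongly_adequate_def)
  have "edom (conjugate J) \<noteq> {}"
  proof -
    obtain \<xi> where "subdiff (conjugate J) \<xi> \<noteq> {}" using ne by (auto simp: dom_subdiff_def)
    then have "\<bar>conjugate J \<xi>\<bar> \<noteq> \<infinity>" unfolding subdiff_def by meson
    then have "\<xi> \<in> edom (conjugate J)" by (auto simp: edom_def)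
    then show ?thesis by blast
  qed
  then have Gam: "conjugate J \<in> Gamma_class"
    by (rule conjugate_in_Gamma_class[OF assms(1)])
  note int = interior_dom_subdiff[OF Gam]
  have diff: "frechet_differentiable_at (conjugate J) \<xi>" if "\<xi> \<in> interior (edom (conjugate J))" for \<xi>
    using that min[of \<xi>] interior_edom_subset_dom_subdiff[OF Gam]
    by (intro strong_min_imp_frechet_differentiable assms) auto
  show "essentially_frechet_differentiable (conjugate J)"
    unfolding essentially_frechet_differentiable_def
  proof (intro conjI ballI allI impI)
    show "interior (dom_subdiff (conjugate J)) \<noteq> {}" using ne op by (simp add: interior_open)
    show "frechet_differentiable_at (conjugate J) \<xi>"
      if "\<xi> \<in> interior (dom_subdiff (conjugate J))" for \<xi>
      using that diff by (simp add: int)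
    show "filterlim (\<lambda>n. norm (gradient (conjugate J) (s n))) at_top sequentially"
      if "\<forall>n. s n \<in> interior (edom (conjugate J))" "b \<in> frontier (edom (conjugate J))"
        "s \<longlonglongrightarrow> b" for s :: "nat \<Rightarrow> 'a \<Rightarrow>\<^sub>L real" and b
      using that diff by (intro gradients_blow_up_if_dom_subdiff_open[OF Gam op]) auto
  qed (rule Gam)
next
  assume ef: "essentially_frechet_differentiable (conjugate J)"
  then have Gam: "conjugate J \<in> Gamma_class"
    and ne: "interior (dom_subdiff (conjugate J)) \<noteq> {}"
    and diff: "\<And>\<xi>. \<xi> \<in> interior (dom_subdiff (conjugate J)) \<Longrightarrow>
      frechet_differentiable_at (conjugate J) \<xi>"
    by (auto simp: essentially_frechet_differentiable_def)
  have op: "open (dom_subdiff (conjugate J))"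
    using essentially_frechet_imp_dom_subdiff_eq[OF ef] by simp
  then have "attains_strong_min (\<lambda>x. J x - ereal (blinfun_apply \<xi> x))"
    if "\<xi> \<in> dom_subdiff (conjugate J)" for \<xi>
    using that diff assms by (intro frechet_differentiable_imp_strong_min) (auto simp: interior_open)
  then show "strongly_adequate J"
    using assms(1) ne op by (auto simp: strongly_adequate_def)
qed

end
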